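(* Let $\mu\in{\cal P}(2)$ with $|\mu|=k$. (i) For $k\leq n$, $$f(\mu,2n)=2^{\ell(\mu)}M_{2\mu}(2n)+\sum_{\tau\in{\cal P}(2,k-1)}\zeta^\tau_\mu(2n)M_{2\tau}(2n).$$ (ii) For $n<k\leq 2n$, $$f(\mu,2n)=\sum_{\tau\in{\cal P}(2,k-1)}\zeta^\tau_\mu(2n)M_{2\tau}(2n).$$ (iii) For $2n<k$ and $\tau\in{\cal P}(2)$ with $|\tau|\leq n$, $\zeta^\tau_\mu(2n)=0$.
   Context: For $s\geq1$, let $K_{2s}$ be the complete graph on $\{1,\ldots,2s\}$ and ${\cal M}_{2s}$ its set of perfect matchings. For $A,B\in{\cal M}_{2s}$, $d(A,B)$ is the partition of $2s$ whose parts are the numbers of vertices of the connected components of the graph with edge set $A\cup B$; it equals $2\nu$ with $\nu\vdash s$. With $S_{2s}$ acting by relabelling vertices, the operators $N_{2\nu}(A)=\sum_{B:\,d(A,B)=2\nu}B$, $\nu\vdash s$, form a basis of ${\cal B}_{2s}=\mathrm{End}_{S_{2s}}({\mathbb C}[{\cal M}_{2s}])$. ${\cal P}(2)$ is the set of partitions with all parts $\geq2$ (including the empty partition), ${\cal P}(2,m)=\{\tau\in{\cal P}(2):|\tau|\leq m\}$, and $\ell(\mu)$ is the number of parts. For $\tau\in{\cal P}(2)$, $M_{2\tau}(2n)=N_{2(\tau,1^{n-|\tau|})}$ if $|\tau|\leq n$ and $0$ otherwise, where $(\tau,1^r)$ appends $r$ parts $1$. $c_\mu(2n)\in{\mathbb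 C}[S_{2n}]$ is the sum of all permutations whose cycles of length $\geq 2$ have lengths $\mu$ (zero if $2n<|\mu|$), and $f(\mu,2n)$ is the operator $x\mapsto c_\mu(2n)x$ on ${\mathbb C}[{\cal M}_{2n}]$. Let $I_s=\{[1,s+1],\ldots,[s,2s]\}$. For $\rho\vdash 2s$ and $\sigma\vdash s$, $m(\rho,2\sigma)$ is the number of permutations of cycle type $\rho$ sending $I_s$ to a fixed $A$ with $d(I_s,A)=2\sigma$. Let $a\vee b=\max(a,b)$. For $\tau,\mu\in{\cal P}(2)$ with $j=|\tau|\leq|\mu|=k$, define $\zeta^\tau_\mu(t)\in{\mathbb Q}[t]$ by: - $\zeta^\tau_\mu=0$ if $j=k$ and $\tau\neq\mu$; - $\zeta^\mu_\mu=2^{\ell(\mu)}$; - for $j<k$, $$\zeta^\tau_\mu(t)=\sum_{r=j\vee\lfloor\frac{k+1}{2}\rfloor}^{k-1}\Big\{\sum_{s=j\vee\lfloor\frac{k+1}{2}\rfloor}^{r}(-1)^{r-s}\binom{r-j}{s-j}m((\mu,1^{2s-k}),2(\tau,1^{s-j}))\Big\}\binom{\frac t2-j}{r-j},$$ with $\binom{x}{m}=x(x-1)\cdots(x-m+1)/m!$. *)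

theory Defs
  imports Complex_Main "HOL-Library.Multiset" "HOL-Combinatorics.Permutations"
begin

definition P2 :: "nat multiset set" where
  "P2 = {\<tau>. \<forall>x\<in>#\<tau>. 2 \<le> x}"

definition pad1 :: "nat multiset \<Rightarrow> nat \<Rightarrow> nat multiset" where
  "pad1 \<tau> r = \<tau> + replicate_mset r 1"

definition dbl :: "nat multiset \<Rightarrow> nat multiset" where
  "dbl \<nu> = image_mset (\<lambda>x. 2 * x) \<nu>"

definition perfect_matchings :: "nat set \<Rightarrow> nat set set set" where
  "perfect_matchings V =
     {M. (\<forall>e\<in>M. card e = 2 \<and> e \<subseteq> V) \<and> (\<forall>v\<in>V. \<exists>!e. e \<in> M \<and> v \<in> e)}"

definition verts :: "nat \<Rightarrow> nat set" where
  "verts s = {1..2*s}"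

definition comp :: "nat set set \<Rightarrow> nat \<Rightarrow> nat set" where
  "comp E v = {w. (v, w) \<in> {(a, b). {a, b} \<in> E}\<^sup>*}"

definition dist_part :: "nat set \<Rightarrow> nat set set \<Rightarrow> nat set set \<Rightarrow> nat multiset" where
  "dist_part V A B = image_mset card (mset_set (comp (A \<union> B) ` V))"

definition relabel :: "(nat \<Rightarrow> nat) \<Rightarrow> nat set set \<Rightarrow> nat set set" where
  "relabel \<sigma> A = (\<lambda>e. \<sigma> ` e) ` A"

definition orb :: "(nat \<Rightarrow> nat) \<Rightarrow> nat \<Rightarrow> nat set" where
  "orb \<sigma> x = {(\<sigma> ^^ k) x | k. True}"

definition cycle_type :: "nat set \<Rightarrow> (nat \<Rightarrow> nat) \<Rightarrow> nat multiset" where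
  "cycle_type V \<sigma> = image_mset card (mset_set (orb \<sigma> ` V))"

text \<open>Vectors of C[M_2n] are functions on matchings vanishing outside M_2n;
  operators are maps on such functions.\<close>
definition vecs :: "nat \<Rightarrow> (nat set set \<Rightarrow> complex) set" where
  "vecs n = {x. \<forall>B. B \<notin> perfect_matchings (verts n) \<longrightarrow> x B = 0}"

text \<open>N_{2 nu}: A \<mapsto> sum of B with d(A,B) = 2 nu, extended linearly (nu a partition of n).\<close>
definition Nop :: "nat \<Rightarrow> nat multiset \<Rightarrow> (nat set set \<Rightarrow> complex) \<Rightarrow> (nat set set \<Rightarrow> complex)" where
  "Nop n \<nu> x = (\<lambda>B. if B \<in> perfect_matchings (verts n) then
      (\<Sum>A\<in>perfect_matchings (verts n). if dist_part (verts n) A B = dbl \<nu> then x A else 0)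
     else 0)"

definition Mop :: "nat \<Rightarrow> nat multiset \<Rightarrow> (nat set set \<Rightarrow> complex) \<Rightarrow> (nat set set \<Rightarrow> complex)" where
  "Mop n \<tau> = (if sum_mset \<tau> \<le> n then Nop n (pad1 \<tau> (n - sum_mset \<tau>)) else (\<lambda>x B. 0))"

text \<open>c_mu(2n): sum of the permutations of {1..2n} whose cycles of length at least 2
  have lengths mu.\<close>
definition cperms :: "nat multiset \<Rightarrow> nat \<Rightarrow> (nat \<Rightarrow> nat) set" where
  "cperms \<mu> n = {\<sigma>. \<sigma> permutes verts n \<and> filter_mset (\<lambda>x. 2 \<le> x) (cycle_type (verts n) \<sigma>) = \<mu>}"

text \<open>f(mu,2n): x \<mapsto> c_mu(2n) x, where a permutation sends the basis vector A to relabel sigma A.\<close>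
definition fop :: "nat multiset \<Rightarrow> nat \<Rightarrow> (nat set set \<Rightarrow> complex) \<Rightarrow> (nat set set \<Rightarrow> complex)" where
  "fop \<mu> n x = (\<lambda>B. \<Sum>\<sigma>\<in>cperms \<mu> n. \<Sum>A\<in>perfect_matchings (verts n).
                     if relabel \<sigma> A = B then x A else 0)"

definition Ist :: "nat \<Rightarrow> nat set set" where
  "Ist s = {{i, s + i} | i. i \<in> {1..s}}"

text \<open>m(rho, 2 sigma) for rho of 2s and sigma of s: number of permutations of {1..2s} of
  cycle type rho sending I_s to a fixed matching A with d(I_s, A) = 2 sigma
  (the count does not depend on the choice of A).\<close>
definition mcount :: "nat \<Rightarrow> nat multiset \<Rightarrow> nat multiset \<Rightarrow> nat" where
  "mcount s \<rho> \<sigma> =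
     (let A = (SOME A. A \<in> perfect_matchings (verts s) \<and> dist_part (verts s) (Ist s) A = dbl \<sigma>)
      in card {\<pi>. \<pi> permutes verts s \<and> cycle_type (verts s) \<pi> = \<rho> \<and> relabel \<pi> (Ist s) = A})"

definition zeta :: "nat multiset \<Rightarrow> nat multiset \<Rightarrow> rat \<Rightarrow> rat" where
  "zeta \<tau> \<mu> t =
    (let j = sum_mset \<tau>; k = sum_mset \<mu>; a = max j ((k + 1) div 2) in
     if j = k then (if \<tau> = \<mu> then 2 ^ size \<mu> else 0)
     else if j < k then
       (\<Sum>r\<in>{a..k - 1}.
          of_int (\<Sum>s\<in>{a..r}. (-1) ^ (r - s) * int ((r - j) choose (s - j))
                     * int (mcount s (pad1 \<mu> (2 * s - k)) (pad1 \<tau> (s - j))))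
          * ((t / 2 - of_nat j) gchoose (r - j)))
     else 0)"

end

theory Submission
  imports Defs "HOL-Combinatorics.Cycles"
begin

text \<open>
  The entry of the operator at a pair of matchings \<open>A, B\<close> counts the permutations with long cycles \<open>\<mu>\<close>
  that carry \<open>A\<close> to \<open>B\<close>. Let the distance of \<open>A\<close> and \<open>B\<close> be \<open>2(\<tau>, 1, \<dots>, 1)\<close> with \<open>j = |\<tau>|\<close> and \<open>k = |\<mu>|\<close>.
  Sort these permutations by the set \<open>S\<close> of common edges whose vertices they move. Those moving only common edges in
  \<open>S\<close> live on the \<open>2(j + |S|)\<close> vertices covered by \<open>S\<close> and the other edges, and are counted by \<open>m\<close>; Moebius
  inversion over \<open>S\<close> gives the alternating inner sum, and the number of choices of \<open>S\<close> gives the binomial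
  coefficient. Each non-common edge of \<open>A\<close> contains a moved vertex and each edge in \<open>S\<close> contains two, so
  \<open>j + 2|S| \<le> k\<close>, which bounds the outer sum when \<open>j < k\<close> and leaves \<open>S\<close> empty when \<open>j = k\<close>. In the latter
  case the permutation is \<open>b \<circ> a\<close>, for the partner involutions \<open>a, b\<close> of \<open>A, B\<close>, on one of the two orbits of
  \<open>b \<circ> a\<close> in each nontrivial component, whence \<open>\<mu> = \<tau>\<close> and the factor 2 for each part.
\<close>

subsection \<open>Orbits and cycle types\<close>

text \<open>The polynomial \<zeta> is built from data that do not know n: m refers to one chosen
  matching on {1, ..., 2s}, and the ranges of r and s depend only on j and k. This leaves two tasks.
  Permutations confined to a subset of the vertices must be compared with permutations of {1, ...,
  2s}; hence the work is done over an arbitrary finite \<open>V\<close>, and pairs of matchings with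
  equal distance are shown to be isomorphic. Encoding a matching by its partner involution turns
  this into a question about the cycles of a product of two involutions. Moreover, the ranges in
  \<zeta> must agree with the true range j <= r <= n. Terms with 2s < k vanish because there are too
  few vertices, which is the origin of floor((k+1)/2); terms with r > n are killed by the binomial,
  as t/2 - j = n - j at t = 2n. In case (iii) every r exceeds n, so nothing survives. Cases (i) and
  (ii) are one identity, since M_{2 mu}(2n) is zero for k > n.\<close>

lemma self_in_orb: "x \<in> orb \<sigma> x"
  unfolding orb_def by (rule CollectI, rule exI[of _ 0]) simp

lemma funpow_in_orb: "(\<sigma> ^^ k) x \<in> orb \<sigma> x"
  by (auto simp: orb_def)

lemma orb_subset: "y \<in> orb \<sigma> x \<Longrightarrow> orb \<sigma> y \<subseteq> orb \<sigma> x"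
  unfolding orb_def by clarsimp (metis comp_apply funpow_add)

text \<open>\<open>orb\<close> collects forward iterates only. Some power of \<open>\<sigma>\<close>
  with exponent above \<open>k\<close> is the identity, so the remaining steps lead from
  \<open>y\<close> back to \<open>x\<close>.\<close>

lemma orb_eq:
  assumes "permutation \<sigma>" "y \<in> orb \<sigma> x"
  shows "orb \<sigma> y = orb \<sigma> x"
proof -
  obtain k where y: "y = (\<sigma> ^^ k) x"
    using assms(2) by (auto simp: orb_def)
  obtain n where n: "\<sigma> ^^ n = id" "n > k"
    using permutation_is_nilpotent'[OF assms(1)] by blast
  have "(\<sigma> ^^ (n - k)) y = x"
    using n unfolding y by (metis comp_apply funpow_add id_apply le_add_diff_inverse2 less_imp_le)
  then have "x \<in> orb \<sigma> y" using funpow_in_orb by metis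
  then show ?thesis using assms(2) orb_subset by blast
qed

lemma orb_step: "permutation \<sigma> \<Longrightarrow> orb \<sigma> (\<sigma> x) = orb \<sigma> x"
  using orb_eq[of \<sigma> "\<sigma> x" x] funpow_in_orb[of 1 \<sigma> x] by simp

lemma orb_cases:
  assumes "permutation \<sigma>"
  shows "orb \<sigma> x = orb \<sigma> y \<or> orb \<sigma> x \<inter> orb \<sigma> y = {}"
  using orb_eq[OF assms] by blast

lemma orb_permutes_subset: "\<sigma> permutes V \<Longrightarrow> x \<in> V \<Longrightarrow> orb \<sigma> x \<subseteq> V"
  by (auto simp: orb_def permutes_in_funpow_image)

lemma orb_fixed: "\<sigma> x = x \<Longrightarrow> orb \<sigma> x = {x}"
proof -
  assume "\<sigma> x = x"
  then have "(\<sigma> ^^ k) x = x" for k by (induction k) auto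
  then show ?thesis by (auto simp: orb_def)
qed

lemma orb_eq_support: "permutation \<sigma> \<Longrightarrow> orb \<sigma> x = set (support \<sigma> x)"
  unfolding support_set orb_def by blast

lemma finite_orb: "permutation \<sigma> \<Longrightarrow> finite (orb \<sigma> x)"
  by (simp add: orb_eq_support)

lemma card_orb: "permutation \<sigma> \<Longrightarrow> card (orb \<sigma> x) = least_power \<sigma> x"
  unfolding orb_eq_support using distinct_card[OF cycle_of_permutation[of \<sigma> x]] by simp

lemma card_orb_pos: "permutation \<sigma> \<Longrightarrow> 0 < card (orb \<sigma> x)"
  by (simp add: card_orb least_power_of_permutation)

lemma card_orb_ge_2: "permutation \<sigma> \<Longrightarrow> \<sigma> x \<noteq> x \<Longrightarrow> 2 \<le> card (orb \<sigma> x)"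
  using least_power_gt_one[of \<sigma> x] by (simp add: card_orb)

text \<open>The first return time of \<open>x\<close> equals the size of its orbit. Equality of
  iterates thus depends on that size alone, which later lets two orbits of equal size be identified
  exponent by exponent.\<close>

lemma funpow_eq_iff_mod:
  assumes "permutation \<sigma>"
  shows "(\<sigma> ^^ i) x = (\<sigma> ^^ j) x \<longleftrightarrow> i mod card (orb \<sigma> x) = j mod card (orb \<sigma> x)"
proof (induction i j rule: linorder_wlog)
  case (le i j)
  have "(\<sigma> ^^ i) x = (\<sigma> ^^ j) x \<longleftrightarrow> (\<sigma> ^^ (j - i)) x = x"
  proof
    show "(\<sigma> ^^ (j - i)) x = x" if "(\<sigma> ^^ i) x = (\<sigma> ^^ j) x"
      using funpow_diff[of \<sigma> i j x] that le assms bij_is_inj permutation_bijective by metis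
    show "(\<sigma> ^^ i) x = (\<sigma> ^^ j) x" if "(\<sigma> ^^ (j - i)) x = x"
      using that le by (metis add_diff_inverse_nat comp_apply funpow_add not_less)
  qed
  also have "\<dots> \<longleftrightarrow> card (orb \<sigma> x) dvd j - i"
    using least_power_dvd[OF assms] card_orb[OF assms] by metis
  also have "\<dots> \<longleftrightarrow> j mod card (orb \<sigma> x) = i mod card (orb \<sigma> x)"
    using mod_eq_iff_dvd_symdiff_nat[of j "card (orb \<sigma> x)" i] le
    by (metis mod_eq_dvd_iff_nat)
  finally show ?case by metis
next
  case (sym i j)
  then show ?case by metis
qed

lemma orb_moved:
  assumes "permutation \<sigma>" "\<sigma> x \<noteq> x" "y \<in> orb \<sigma> x"
  shows "\<sigma> y \<noteq> y"
proof
  assume "\<sigma> y = y"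
  then have "orb \<sigma> x = {y}" using orb_fixed orb_eq[OF assms(1,3)] by simp
  then show False using card_orb_ge_2[OF assms(1,2)] by simp
qed

text \<open>Since a fixed point contributes a cycle of length 1, the lengths of the long cycles do not depend
  on the ambient set \<^term>\<open>V\<close>, unlike \<^const>\<open>cycle_type\<close>.\<close>

definition long_cycles :: "(nat \<Rightarrow> nat) \<Rightarrow> nat multiset" where
  "long_cycles \<sigma> = image_mset card (mset_set (orb \<sigma> ` {v. \<sigma> v \<noteq> v}))"

lemma finite_moved: "permutation \<sigma> \<Longrightarrow> finite {v. \<sigma> v \<noteq> v}"
  by (rule permutation_finite_support)

lemma long_cycles_in_P2: "permutation \<sigma> \<Longrightarrow> long_cycles \<sigma> \<in> P2"
  using finite_moved[of \<sigma>] card_orb_ge_2[of \<sigma>] by (auto simp: long_cycles_def P2_def)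

lemma sum_card_disjoint_image:
  assumes "finite X" "\<And>C. C \<in> X \<Longrightarrow> finite C"
    "\<And>C D. C \<in> X \<Longrightarrow> D \<in> X \<Longrightarrow> C \<noteq> D \<Longrightarrow> C \<inter> D = {}"
  shows "sum_mset (image_mset card (mset_set X)) = card (\<Union>X)"
  using card_Union_disjoint[of X] assms
  by (simp add: sum_unfold_sum_mset disjoint_def pairwise_def disjnt_def)

lemma sum_long_cycles:
  assumes "permutation \<sigma>"
  shows "sum_mset (long_cycles \<sigma>) = card {v. \<sigma> v \<noteq> v}"
proof -
  have "sum_mset (long_cycles \<sigma>) = card (\<Union>(orb \<sigma> ` {v. \<sigma> v \<noteq> v}))"
    unfolding long_cycles_def
    by (rule sum_card_disjoint_image)
      (use finite_moved finite_orb orb_cases assms in \<open>blast+\<close>)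
  also have "\<Union>(orb \<sigma> ` {v. \<sigma> v \<noteq> v}) = {v. \<sigma> v \<noteq> v}"
    using orb_moved[OF assms] self_in_orb by blast
  finally show ?thesis .
qed

lemma cycle_type_eq:
  assumes "finite V" "\<sigma> permutes V"
  shows "cycle_type V \<sigma> = pad1 (long_cycles \<sigma>) (card V - sum_mset (long_cycles \<sigma>))"
proof -
  have perm: "permutation \<sigma>" using assms permutation_permutes by blast
  let ?D = "{v. \<sigma> v \<noteq> v}"
  have sub: "?D \<subseteq> V" using assms(2) permutes_not_in by fastforce
  have fin: "finite ?D" by (rule finite_moved[OF perm])
  have fixed: "orb \<sigma> ` (V - ?D) = (\<lambda>v. {v}) ` (V - ?D)"
    by (rule image_cong) (auto simp: orb_fixed)
  have "orb \<sigma> ` V = orb \<sigma> ` ?D \<union> (\<lambda>v. {v}) ` (V - ?D)"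
    using sub fixed by blast
  moreover have "orb \<sigma> x \<noteq> {v}" if "\<sigma> x \<noteq> x" "\<sigma> v = v" for x v
    using self_in_orb[of x \<sigma>] that by auto
  then have "orb \<sigma> ` ?D \<inter> (\<lambda>v. {v}) ` (V - ?D) = {}"
    by blast
  ultimately have "cycle_type V \<sigma> = long_cycles \<sigma> + image_mset card (mset_set ((\<lambda>v. {v}) ` (V - ?D)))"
    using fin assms(1) by (simp add: cycle_type_def long_cycles_def mset_set_Union)
  also have "image_mset card (mset_set ((\<lambda>v. {v}) ` (V - ?D))) = replicate_mset (card (V - ?D)) 1"
    by (subst image_mset_mset_set[symmetric]) (auto simp: inj_on_def multiset.map_comp o_def image_mset_const_eq)
  also have "card (V - ?D) = card V - sum_mset (long_cycles \<sigma>)"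
    using sub fin by (simp add: sum_long_cycles[OF perm] card_Diff_subset)
  finally show ?thesis by (simp add: pad1_def)
qed

lemma filter_ge_2_pad1: "\<mu> \<in> P2 \<Longrightarrow> filter_mset ((\<le>) 2) (pad1 \<mu> r) = \<mu>"
  by (rule multiset_eqI) (auto simp: pad1_def P2_def not_in_iff)

lemma filter_cycle_type:
  assumes "finite V" "\<sigma> permutes V"
  shows "filter_mset ((\<le>) 2) (cycle_type V \<sigma>) = long_cycles \<sigma>"
  using assms cycle_type_eq filter_ge_2_pad1 long_cycles_in_P2 permutation_permutes by metis

lemma cycle_type_eq_pad1_iff:
  assumes "finite V" "\<sigma> permutes V" "\<mu> \<in> P2"
  shows "cycle_type V \<sigma> = pad1 \<mu> (card V - sum_mset \<mu>) \<longleftrightarrow> long_cycles \<sigma> = \<mu>"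
  using assms cycle_type_eq filter_cycle_type filter_ge_2_pad1 by metis

section \<open>Transport under conjugation by a bijection\<close>

lemma funpow_conj:
  assumes "bij \<Phi>"
  shows "((\<Phi> \<circ> \<sigma> \<circ> inv \<Phi>) ^^ k) (\<Phi> x) = \<Phi> ((\<sigma> ^^ k) x)"
  by (induction k) (use assms in \<open>auto simp: bij_is_inj inv_f_f\<close>)

lemma orb_conj: "bij \<Phi> \<Longrightarrow> orb (\<Phi> \<circ> \<sigma> \<circ> inv \<Phi>) (\<Phi> x) = \<Phi> ` orb \<sigma> x"
  unfolding orb_def funpow_conj by blast

text \<open>The function \<open>F\<close> covers two uses: cycle lengths, with the identity, and
  matching types, where component sizes are halved.\<close>

lemma image_mset_card_image:
  assumes "inj \<Phi>"
  shows "image_mset (\<lambda>C. F (card C)) (mset_set ((`) \<Phi> ` X)) = image_mset (\<lambda>C. F (card C)) (mset_set X)"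
  by (subst image_mset_mset_set[symmetric])
    (use assms in \<open>auto simp: multiset.map_comp o_def card_image inj_on_image inj_on_subset inj_image_eq_iff inj_on_def\<close>)

text \<open>Stated for two maps so that \<open>\<tau> = id\<close> gives the points moved by a
  permutation, and two partner maps give the vertices where they disagree.\<close>

lemma moved_conj:
  assumes "bij \<Phi>"
  shows "{v. (\<Phi> \<circ> \<sigma> \<circ> inv \<Phi>) v \<noteq> \<Phi> ((\<tau> \<circ> inv \<Phi>) v)} = \<Phi> ` {v. \<sigma> v \<noteq> \<tau> v}"
proof -
  have "v \<in> \<Phi> ` {v. \<sigma> v \<noteq> \<tau> v}" if "\<sigma> (inv \<Phi> v) \<noteq> \<tau> (inv \<Phi> v)" for v
    using that assms by (intro image_eqI[of _ _ "inv \<Phi> v"]) (auto simp: bij_is_surj surj_f_inv_f)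
  then show ?thesis
    using assms by (auto simp: bij_is_inj inv_f_f inj_eq)
qed

lemma long_cycles_conj:
  assumes "bij \<Phi>"
  shows "long_cycles (\<Phi> \<circ> \<sigma> \<circ> inv \<Phi>) = long_cycles \<sigma>"
proof -
  have "{v. (\<Phi> \<circ> \<sigma> \<circ> inv \<Phi>) v \<noteq> v} = \<Phi> ` {v. \<sigma> v \<noteq> v}"
    using moved_conj[OF assms, of \<sigma> id] assms by (simp add: bij_is_surj surj_f_inv_f)
  then have "orb (\<Phi> \<circ> \<sigma> \<circ> inv \<Phi>) ` {v. (\<Phi> \<circ> \<sigma> \<circ> inv \<Phi>) v \<noteq> v} = (`) \<Phi> ` orb \<sigma> ` {v. \<sigma> v \<noteq> v}"
    by (simp add: image_image orb_conj[OF assms])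
  then show ?thesis
    using image_mset_card_image[of \<Phi> id] assms by (simp add: long_cycles_def bij_is_inj)
qed

subsection \<open>Perfect matchings as involutions\<close>

text \<open>Applied with \<open>card\<close> for both labels, this pairs off the components of two
  unions of matchings by size.\<close>

lemma ex_bij_betw_of_image_mset_eq:
  assumes "finite A" "finite B" "image_mset f (mset_set A) = image_mset h (mset_set B)"
  shows "\<exists>\<phi>. bij_betw \<phi> A B \<and> (\<forall>x\<in>A. h (\<phi> x) = f x)"
  using assms
proof (induction A arbitrary: B rule: finite_induct)
  case empty
  then show ?case by (auto simp: mset_set_empty_iff bij_betw_def)
next
  case (insert x A)
  have "f x \<in># image_mset h (mset_set B)"
    using insert.hyps insert.prems(2)[symmetric] by simp
  then obtain y where y: "y \<in> B" "h y = f x"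
    using insert.prems(1) by auto
  have "image_mset h (mset_set B) = add_mset (h y) (image_mset h (mset_set (B - {y})))"
    using insert.prems(1) y by (simp add: mset_set.remove)
  then have "image_mset f (mset_set A) = image_mset h (mset_set (B - {y}))"
    using insert.hyps insert.prems(2) y by simp
  then obtain \<phi> where \<phi>: "bij_betw \<phi> A (B - {y})" "\<forall>x\<in>A. h (\<phi> x) = f x"
    using insert.IH[of "B - {y}"] insert.prems(1) by auto
  have "bij_betw (\<phi>(x := y)) (insert x A) (insert y (B - {y}))"
    using \<phi>(1) insert.hyps
    by (intro bij_betw_combine[of _ "{x}" "{y}", simplified])
      (auto simp: bij_betw_def inj_on_def)
  then show ?case
    using \<phi>(2) y insert.hyps by (intro exI[of _ "\<phi>(x := y)"]) (auto simp: insert_absorb fun_upd_def)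
qed

text \<open>Since \<open>V\<close> and \<open>W\<close> have the same size, so do
  \<open>W - V\<close> and \<open>V - W\<close>; a bijection between these closes up
  \<open>V \<union> W\<close>, and the identity does the rest. A bijection of all naturals is wanted
  because relabelling is expressed by conjugation with \<open>\<Phi>\<close> and
  \<open>inv \<Phi>\<close>.\<close>

lemma extend_bij_betw:
  fixes V W :: "'a set"
  assumes "finite V" "bij_betw \<phi> V W"
  shows "\<exists>\<Phi>. bij \<Phi> \<and> (\<forall>v\<in>V. \<Phi> v = \<phi> v)"
proof -
  have fin: "finite W" using assms bij_betw_finite by blast
  have "card (W - V) = card (V - W)"
    using card_le_sym_Diff card_le_sym_Diff[of V W] card_le_sym_Diff[of W V] assms fin bij_betw_same_card[OF assms(2)]
    by (simp add: le_antisym)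
  then obtain \<psi> where \<psi>: "bij_betw \<psi> (W - V) (V - W)"
    using fin assms(1) finite_same_card_bij by blast
  define \<Phi> where "\<Phi> v = (if v \<in> V then \<phi> v else if v \<in> W then \<psi> v else v)" for v
  have "bij_betw \<Phi> V W" using assms(2) by (rule bij_betw_cong[THEN iffD1, rotated]) (simp add: \<Phi>_def)
  moreover have "bij_betw \<Phi> (W - V) (V - W)"
    using \<psi> by (rule bij_betw_cong[THEN iffD1, rotated]) (simp add: \<Phi>_def)
  moreover have "bij_betw \<Phi> (- (V \<union> W)) (- (V \<union> W))"
    using bij_betw_id by (rule bij_betw_cong[THEN iffD1, rotated]) (simp add: \<Phi>_def)
  ultimately have "bij_betw \<Phi> (V \<union> (W - V) \<union> - (V \<union> W)) (W \<union> (V - W) \<union> - (V \<union> W))"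
    by (intro bij_betw_combine) auto
  moreover have "V \<union> (W - V) \<union> - (V \<union> W) = UNIV" "W \<union> (V - W) \<union> - (V \<union> W) = UNIV"
    by auto
  ultimately show ?thesis by (intro exI[of _ \<Phi>]) (simp add: \<Phi>_def)
qed

text \<open>The partner map of a perfect matching. It is the identity outside \<open>V\<close>, so
  the map is determined by the matching and products of partner maps are permutations of
  \<open>V\<close>.\<close>

definition fpf_involution :: "nat set \<Rightarrow> (nat \<Rightarrow> nat) \<Rightarrow> bool" where
  "fpf_involution V a \<longleftrightarrow> a permutes V \<and> (\<forall>v. a (a v) = v) \<and> (\<forall>v\<in>V. a v \<noteq> v)"

definition edges :: "nat set \<Rightarrow> (nat \<Rightarrow> nat) \<Rightarrow> nat set set" where
  "edges V a = (\<lambda>v. {v, a v}) ` V"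

lemma fpf_involution_in_iff: "fpf_involution V a \<Longrightarrow> a v \<in> V \<longleftrightarrow> v \<in> V"
  by (simp add: fpf_involution_def permutes_in_image)

lemma fpf_involution_not_in: "fpf_involution V a \<Longrightarrow> v \<notin> V \<Longrightarrow> a v = v"
  unfolding fpf_involution_def using permutes_not_in by metis

lemma fpf_involution_inv: "fpf_involution V a \<Longrightarrow> a (a v) = v"
  by (simp add: fpf_involution_def)

lemma fpf_involution_neq: "fpf_involution V a \<Longrightarrow> v \<in> V \<Longrightarrow> a v \<noteq> v"
  by (simp add: fpf_involution_def)

lemma edges_iff: "fpf_involution V a \<Longrightarrow> {v, w} \<in> edges V a \<longleftrightarrow> v \<in> V \<and> w = a v"
proof
  assume a: "fpf_involution V a" and "{v, w} \<in> edges V a"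
  then obtain u where "u \<in> V" "v = u \<and> w = a u \<or> v = a u \<and> w = u"
    by (auto simp: edges_def doubleton_eq_iff)
  then show "v \<in> V \<and> w = a v"
    using fpf_involution_in_iff[OF a, of u] fpf_involution_inv[OF a, of u] by metis
qed (auto simp: edges_def)

lemma edges_perfect_matching:
  assumes "fpf_involution V a"
  shows "edges V a \<in> perfect_matchings V"
proof -
  have eq: "e = {v, a v}" if e: "e \<in> edges V a" and v: "v \<in> e" for e v
  proof -
    obtain u where "e = {u, a u}" using e by (auto simp: edges_def)
    then show ?thesis using v fpf_involution_inv[OF assms, of u] by auto
  qed
  have "card e = 2 \<and> e \<subseteq> V" if e: "e \<in> edges V a" for e
  proof -
    obtain v where v: "v \<in> V" "e = {v, a v}" using e by (auto simp: edges_def)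
    then show ?thesis using fpf_involution_neq[OF assms v(1)] fpf_involution_in_iff[OF assms, of v]
      by (simp add: card_insert_if eq_commute[of v])
  qed
  moreover have "\<exists>!e. e \<in> edges V a \<and> v \<in> e" if "v \<in> V" for v
  proof (rule ex1I[of _ "{v, a v}"])
    show "{v, a v} \<in> edges V a \<and> v \<in> {v, a v}" using that by (simp add: edges_def)
  qed (use eq in simp)
  ultimately show ?thesis unfolding perfect_matchings_def by simp
qed

lemma perfect_matching_edges:
  assumes "A \<in> perfect_matchings V"
  shows "\<exists>a. fpf_involution V a \<and> A = edges V a"
proof -
  have edge: "card e = 2" "e \<subseteq> V" if "e \<in> A" for e
    using assms that by (auto simp: perfect_matchings_def)
  have uniq: "\<exists>!e. e \<in> A \<and> v \<in> e" if "v \<in> V" for v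
    using assms that by (auto simp: perfect_matchings_def)
  have "\<exists>w. {v, w} \<in> A \<and> w \<noteq> v \<and> w \<in> V" if v: "v \<in> V" for v
  proof -
    obtain e where e: "e \<in> A" "v \<in> e" using uniq[OF v] by blast
    obtain x y where xy: "e = {x, y}" "x \<noteq> y" using edge(1)[OF e(1)] by (auto simp: card_2_iff)
    then show ?thesis using e edge(2)[OF e(1)] by (cases "v = x") (auto simp: insert_commute)
  qed
  then obtain f where f: "\<And>v. v \<in> V \<Longrightarrow> {v, f v} \<in> A \<and> f v \<noteq> v \<and> f v \<in> V" by metis
  define a where "a v = (if v \<in> V then f v else v)" for v
  have inv: "a (a v) = v" for v
  proof (cases "v \<in> V")
    case True
    then have "f v \<in> V" "{v, f v} \<in> A" "{f v, f (f v)} \<in> A" using f by blast+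
    then have "{v, f v} = {f v, f (f v)}" using uniq[of "f v"] by blast
    then have "f (f v) = v" using f[OF True] by (auto simp: doubleton_eq_iff)
    then show ?thesis using f[OF True] True by (simp add: a_def)
  qed (simp add: a_def)
  have "a permutes V"
    unfolding permutes_def
  proof (intro conjI allI impI ex1I)
    show "a v = v" if "v \<notin> V" for v using that by (simp add: a_def)
    show "a (a v) = v" for v by (rule inv)
    show "w = a v" if "a w = v" for v w using inv[of w] that by simp
  qed
  then have fpf_involution: "fpf_involution V a" using inv f unfolding fpf_involution_def by (simp add: a_def)
  moreover have "A = edges V a"
  proof
    show "edges V a \<subseteq> A" using f by (auto simp: edges_def a_def)
    show "A \<subseteq> edges V a"
    proof
      fix e assume e: "e \<in> A"
      obtain v where v: "v \<in> e" "v \<in> V" using edge[OF e] by (auto simp: card_2_iff)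
      then have "{v, a v} \<in> A" using f by (simp add: a_def)
      then have "e = {v, a v}" using uniq[OF v(2)] e v by blast
      then show "e \<in> edges V a" using v by (auto simp: edges_def)
    qed
  qed
  ultimately show ?thesis by blast
qed

lemma relabel_edges:
  assumes "bij \<Phi>"
  shows "relabel \<Phi> (edges V a) = edges (\<Phi> ` V) (\<Phi> \<circ> a \<circ> inv \<Phi>)"
  using assms by (auto simp: relabel_def edges_def image_image bij_is_inj inv_f_f)

lemma fpf_involution_conj:
  assumes "bij \<Phi>" "fpf_involution V a"
  shows "fpf_involution (\<Phi> ` V) (\<Phi> \<circ> a \<circ> inv \<Phi>)"
proof -
  let ?a = "\<Phi> \<circ> a \<circ> inv \<Phi>"
  have surj: "\<Phi> (inv \<Phi> v) = v" for v using assms(1) by (simp add: bij_is_surj surj_f_inv_f)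
  have inj: "inv \<Phi> (\<Phi> v) = v" for v using assms(1) by (simp add: bij_is_inj inv_f_f)
  have invol: "?a (?a v) = v" for v
    using assms(2) by (simp add: fpf_involution_def inj surj)
  moreover have "?a v = v" if "v \<notin> \<Phi> ` V" for v
  proof -
    have "inv \<Phi> v \<notin> V" using that surj[of v] by force
    then have "a (inv \<Phi> v) = inv \<Phi> v" using fpf_involution_not_in[OF assms(2)] by blast
    then show ?thesis by (simp add: surj)
  qed
  moreover have "?a v \<noteq> v" if v: "v \<in> \<Phi> ` V" for v
  proof -
    obtain w where "w \<in> V" "v = \<Phi> w" using v by blast
    then show ?thesis using assms(2) inj[of "a w"] inj[of w] unfolding fpf_involution_def by (metis comp_apply)
  qed
  moreover have "\<exists>!w. ?a w = v" for v
  proof (rule ex1I[of _ "?a v"])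
    show "?a (?a v) = v" by (rule invol)
    show "w = ?a v" if "?a w = v" for w using invol[of w] that by simp
  qed
  ultimately show ?thesis unfolding fpf_involution_def permutes_def by blast
qed

lemma edges_eq_iff:
  assumes "fpf_involution V a" "fpf_involution V b"
  shows "edges V a = edges V b \<longleftrightarrow> a = b"
proof
  assume eq: "edges V a = edges V b"
  show "a = b"
  proof
    fix v
    show "a v = b v"
      using edges_iff[OF assms(1), of v "a v"] edges_iff[OF assms(2), of v "a v"] eq assms
      by (cases "v \<in> V") (auto simp: fpf_involution_not_in[OF assms(1)] fpf_involution_not_in[OF assms(2)])
  qed
qed simp

text \<open>Relabelling a matching conjugates its partner map, so carrying one matching to another
  is an intertwining relation. Checking it on \<open>V\<close> is enough because all three maps fix
  every vertex outside.\<close>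

lemma relabel_edges_eq_iff:
  assumes "\<sigma> permutes V" "fpf_involution V a" "fpf_involution V b"
  shows "relabel \<sigma> (edges V a) = edges V b \<longleftrightarrow> (\<forall>v\<in>V. \<sigma> (a v) = b (\<sigma> v))"
proof -
  have bij: "bij \<sigma>" and im: "\<sigma> ` V = V" using assms(1) by (auto simp: permutes_bij permutes_image)
  have "relabel \<sigma> (edges V a) = edges V b \<longleftrightarrow> \<sigma> \<circ> a \<circ> inv \<sigma> = b"
    using edges_eq_iff[of V "\<sigma> \<circ> a \<circ> inv \<sigma>" b] relabel_edges[OF bij, of V a] fpf_involution_conj[OF bij assms(2)] assms(3)
    by (simp add: im)
  also have "\<dots> \<longleftrightarrow> (\<forall>v. \<sigma> (a v) = b (\<sigma> v))"
  proof
    assume "\<sigma> \<circ> a \<circ> inv \<sigma> = b"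
    then show "\<forall>v. \<sigma> (a v) = b (\<sigma> v)" using bij by (auto simp: bij_is_inj inv_f_f)
  next
    assume "\<forall>v. \<sigma> (a v) = b (\<sigma> v)"
    then show "\<sigma> \<circ> a \<circ> inv \<sigma> = b" using bij by (simp add: fun_eq_iff bij_is_surj surj_f_inv_f)
  qed
  also have "\<dots> \<longleftrightarrow> (\<forall>v\<in>V. \<sigma> (a v) = b (\<sigma> v))"
    proof (intro iffI allI ballI)
    fix v assume *: "\<forall>v\<in>V. \<sigma> (a v) = b (\<sigma> v)"
    show "\<sigma> (a v) = b (\<sigma> v)"
      using * assms by (cases "v \<in> V") (auto simp: fpf_involution_not_in[OF assms(2)] fpf_involution_not_in[OF assms(3)] permutes_not_in[OF assms(1)])
  qed simp
  finally show ?thesis .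
qed

lemma relabel_perfect_matching:
  assumes "bij \<Phi>" "A \<in> perfect_matchings V"
  shows "relabel \<Phi> A \<in> perfect_matchings (\<Phi> ` V)"
proof -
  obtain a where "fpf_involution V a" "A = edges V a" using perfect_matching_edges[OF assms(2)] by blast
  then show ?thesis
    using edges_perfect_matching[OF fpf_involution_conj[OF assms(1)]] relabel_edges[OF assms(1)] by simp
qed

subsection \<open>Components of the union of two matchings\<close>

lemma comp_refl: "v \<in> comp E v"
  by (simp add: comp_def)

lemma comp_step: "w \<in> comp E v \<Longrightarrow> {w, x} \<in> E \<Longrightarrow> x \<in> comp E v"
  by (auto simp: comp_def intro: rtrancl_into_rtrancl)

text \<open>The component of \<^term>\<open>v\<close> in the union of the matchings of \<^term>\<open>a\<close> and \<^term>\<open>b\<close> is the orbit under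
  the dihedral group generated by the two involutions. Its two orbits under \<^term>\<open>b \<circ> a\<close> have equal size and are
  exchanged by \<^term>\<open>a\<close>.\<close>

definition dihedral_orb :: "(nat \<Rightarrow> nat) \<Rightarrow> (nat \<Rightarrow> nat) \<Rightarrow> nat \<Rightarrow> nat set" where
  "dihedral_orb a b v = orb (b \<circ> a) v \<union> a ` orb (b \<circ> a) v"

text \<open>In the notation of the statement, the distance of the two matchings is twice the partition
  obtained from \<^term>\<open>matching_type a b\<close> by appending parts 1.\<close>

definition matching_type :: "(nat \<Rightarrow> nat) \<Rightarrow> (nat \<Rightarrow> nat) \<Rightarrow> nat multiset" where
  "matching_type a b = image_mset (\<lambda>C. card C div 2) (mset_set (dihedral_orb a b ` {v. a v \<noteq> b v}))"

locale matching_pair =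
  fixes V :: "nat set" and a b :: "nat \<Rightarrow> nat"
  assumes fin: "finite V" and fpf_involution_a: "fpf_involution V a" and fpf_involution_b: "fpf_involution V b"
begin

lemma aa: "a (a v) = v" and bb: "b (b v) = v"
  using fpf_involution_a fpf_involution_b by (auto simp: fpf_involution_def)

lemma a_in: "a v \<in> V \<longleftrightarrow> v \<in> V" and b_in: "b v \<in> V \<longleftrightarrow> v \<in> V"
  using fpf_involution_in_iff fpf_involution_a fpf_involution_b by blast+

lemma a_eq_iff: "a v = a w \<longleftrightarrow> v = w"
  using aa by metis

lemma inj_a: "inj a"
  by (simp add: inj_def a_eq_iff)

lemma a_neq: "v \<in> V \<Longrightarrow> a v \<noteq> v" and b_neq: "v \<in> V \<Longrightarrow> b v \<noteq> v"
  using fpf_involution_neq fpf_involution_a fpf_involution_b by blast+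

lemma moved_in: "a v \<noteq> b v \<Longrightarrow> v \<in> V"
  using fpf_involution_not_in[OF fpf_involution_a, of v] fpf_involution_not_in[OF fpf_involution_b, of v] by fastforce

lemma ba_permutes: "b \<circ> a permutes V"
  using fpf_involution_a fpf_involution_b by (auto simp: fpf_involution_def intro: permutes_compose)

lemma ba_permutation: "permutation (b \<circ> a)"
  using ba_permutes fin permutation_permutes by blast

lemma ba_fixed_iff: "(b \<circ> a) v = v \<longleftrightarrow> a v = b v"
  using bb by (metis comp_apply)

lemma orb_in: "v \<in> V \<Longrightarrow> x \<in> orb (b \<circ> a) v \<Longrightarrow> x \<in> V"
  using orb_permutes_subset[OF ba_permutes] by blast

text \<open>With g = b a this is the dihedral relation: conjugation by a inverts g. It is written as
  g^l a g^l = a to avoid inverses.\<close>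

lemma funpow_a_funpow: "((b \<circ> a) ^^ l) (a (((b \<circ> a) ^^ l) v)) = a v"
proof (induction l)
  case (Suc l)
  have "((b \<circ> a) ^^ Suc l) (a (((b \<circ> a) ^^ Suc l) v))
      = ((b \<circ> a) ^^ l) ((b \<circ> a) (a ((b \<circ> a) (((b \<circ> a) ^^ l) v))))"
    by (simp add: funpow_swap1)
  also have "(b \<circ> a) (a ((b \<circ> a) (((b \<circ> a) ^^ l) v))) = a (((b \<circ> a) ^^ l) v)"
    by (simp add: aa bb)
  also note Suc
  finally show ?case .
qed simp

text \<open>If a v = g^i v with g = b a, look at the midpoint z = g^l v with l = i div 2. The
  dihedral relation gives a z = z for even i and b (a z) = a z for odd i, but neither involution has
  a fixed point in \<open>V\<close>.\<close>

lemma a_notin_orb: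
  assumes "v \<in> V"
  shows "a v \<notin> orb (b \<circ> a) v"
proof
  let ?g = "b \<circ> a"
  assume "a v \<in> orb ?g v"
  then obtain i where i: "a v = (?g ^^ i) v" by (auto simp: orb_def)
  have inj: "inj (?g ^^ l)" for l
    using ba_permutes by (intro inj_fn permutes_inj)
  define l where "l = i div 2"
  define z where "z = (?g ^^ l) v"
  have z: "z \<in> V" using orb_in[OF assms] funpow_in_orb by (simp add: z_def)
  have az: "(?g ^^ l) (a z) = (?g ^^ i) v"
    using funpow_a_funpow[of l v] i by (simp add: z_def)
  have "(?g ^^ i) v = (?g ^^ l) z" if "i = l + l"
    unfolding that z_def funpow_add by simp
  moreover have "(?g ^^ i) v = (?g ^^ l) (?g z)" if "i = l + Suc l"
    unfolding that z_def funpow_add by simp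
  moreover have "i = l + l \<or> i = l + Suc l" unfolding l_def by presburger
  ultimately have "(?g ^^ l) (a z) = (?g ^^ l) z \<or> (?g ^^ l) (a z) = (?g ^^ l) (?g z)"
    using az by metis
  then have "a z = z \<or> a z = ?g z" using inj by (metis injD)
  then show False using a_neq[OF z] b_neq[of "a z"] a_in[of z] z by (auto simp: eq_commute[of "a z"])
qed

lemma orb_disjoint:
  assumes "v \<in> V"
  shows "orb (b \<circ> a) v \<inter> a ` orb (b \<circ> a) v = {}"
  using a_notin_orb orb_in[OF assms] orb_eq[OF ba_permutation] by blast

lemma self_in_dihedral_orb: "v \<in> dihedral_orb a b v"
  using self_in_orb by (simp add: dihedral_orb_def)

lemma a_in_dihedral_orb: "x \<in> dihedral_orb a b v \<Longrightarrow> a x \<in> dihedral_orb a b v"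
  by (auto simp: dihedral_orb_def aa)

text \<open>On the orbit of \<open>v\<close>, b is a after the inverse of
  \<open>b \<circ> a\<close>, hence lands in the mirror image; on the mirror image it undoes a and
  applies \<open>b \<circ> a\<close>.\<close>

lemma b_in_dihedral_orb:
  assumes "x \<in> dihedral_orb a b v"
  shows "b x \<in> dihedral_orb a b v"
  using assms unfolding dihedral_orb_def
proof
  assume x: "x \<in> orb (b \<circ> a) v"
  have "orb (b \<circ> a) (a (b x)) = orb (b \<circ> a) x"
    using orb_step[OF ba_permutation, of "a (b x)"] by (simp add: aa bb)
  then have "a (b x) \<in> orb (b \<circ> a) v"
    using x self_in_orb orb_eq[OF ba_permutation x] by blast
  then have "a (a (b x)) \<in> a ` orb (b \<circ> a) v" by blast
  then show "b x \<in> orb (b \<circ> a) v \<union> a ` orb (b \<circ> a) v" by (simp add: aa)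
next
  assume "x \<in> a ` orb (b \<circ> a) v"
  then obtain y where y: "y \<in> orb (b \<circ> a) v" "x = a y" by blast
  have "(b \<circ> a) y \<in> orb (b \<circ> a) v"
    using y(1) orb_step[OF ba_permutation, of y] orb_eq[OF ba_permutation y(1)]
      self_in_orb[of "(b \<circ> a) y" "b \<circ> a"] by simp
  then show "b x \<in> orb (b \<circ> a) v \<union> a ` orb (b \<circ> a) v" using y by simp
qed

lemma comp_eq_dihedral_orb:
  assumes "v \<in> V"
  shows "comp (edges V a \<union> edges V b) v = dihedral_orb a b v"
proof
  have step: "y = a x \<or> y = b x" if "{x, y} \<in> edges V a \<union> edges V b" for x y
    using that edges_iff[OF fpf_involution_a] edges_iff[OF fpf_involution_b] by blast
  show "comp (edges V a \<union> edges V b) v \<subseteq> dihedral_orb a b v"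
  proof
    fix w assume "w \<in> comp (edges V a \<union> edges V b) v"
    then have "(v, w) \<in> {(x, y). {x, y} \<in> edges V a \<union> edges V b}\<^sup>*" by (simp add: comp_def)
    then show "w \<in> dihedral_orb a b v"
    proof induction
      case base
      show ?case by (rule self_in_dihedral_orb)
    next
      case (step x y)
      then show ?case using \<open>\<And>y x. _ \<Longrightarrow> y = a x \<or> y = b x\<close> a_in_dihedral_orb b_in_dihedral_orb by blast
    qed
  qed
  let ?C = "comp (edges V a \<union> edges V b) v"
  have a: "a x \<in> ?C" if "x \<in> ?C" "x \<in> V" for x
    using comp_step[OF that(1), of "a x"] edges_iff[OF fpf_involution_a] that(2) by blast
  have b: "b x \<in> ?C" if "x \<in> ?C" "x \<in> V" for x
    using comp_step[OF that(1), of "b x"] edges_iff[OF fpf_involution_b] that(2) by blast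
  have "((b \<circ> a) ^^ k) v \<in> ?C \<and> ((b \<circ> a) ^^ k) v \<in> V" for k
    by (induction k) (use assms a b a_in b_in comp_refl in auto)
  then show "dihedral_orb a b v \<subseteq> ?C"
    using a by (auto simp: dihedral_orb_def orb_def)
qed

lemma dihedral_orb_in:
  assumes "v \<in> V" "x \<in> dihedral_orb a b v"
  shows "x \<in> V"
  using assms(2) orb_in[OF assms(1)] a_in unfolding dihedral_orb_def by blast

text \<open>By the dihedral relation the forward orbit of a (g^k v) reaches a v, where g = b a. This
  gives one inclusion, and the same inclusion at a v gives the other.\<close>

lemma orb_a: "orb (b \<circ> a) (a v) = a ` orb (b \<circ> a) v"
proof -
  have *: "a ` orb (b \<circ> a) v \<subseteq> orb (b \<circ> a) (a v)" for v
  proof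
    fix x assume "x \<in> a ` orb (b \<circ> a) v"
    then obtain k where k: "x = a (((b \<circ> a) ^^ k) v)" by (auto simp: orb_def)
    then have "a v = ((b \<circ> a) ^^ k) x" using funpow_a_funpow by simp
    then have "a v \<in> orb (b \<circ> a) x" using funpow_in_orb by metis
    then show "x \<in> orb (b \<circ> a) (a v)" using orb_eq[OF ba_permutation] self_in_orb by metis
  qed
  have "a ` orb (b \<circ> a) (a v) \<subseteq> orb (b \<circ> a) v" using *[of "a v"] by (simp add: aa)
  then have "a ` a ` orb (b \<circ> a) (a v) \<subseteq> a ` orb (b \<circ> a) v" by blast
  then show ?thesis using *[of v] by (simp add: image_image aa subset_antisym)
qed

lemma dihedral_orb_eq:
  assumes "x \<in> dihedral_orb a b v"
  shows "dihedral_orb a b x = dihedral_orb a b v"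
proof -
  have "orb (b \<circ> a) x = orb (b \<circ> a) v \<or> orb (b \<circ> a) x = a ` orb (b \<circ> a) v"
    using assms orb_eq[OF ba_permutation] unfolding dihedral_orb_def by (metis Un_iff imageE orb_a)
  then show ?thesis unfolding dihedral_orb_def
    by (elim disjE) (simp_all add: image_image aa Un_commute)
qed

lemma dihedral_orb_cases: "dihedral_orb a b v = dihedral_orb a b w \<or> dihedral_orb a b v \<inter> dihedral_orb a b w = {}"
  using dihedral_orb_eq by blast

lemma finite_dihedral_orb: "finite (dihedral_orb a b v)"
  by (simp add: dihedral_orb_def finite_orb ba_permutation)

lemma card_dihedral_orb:
  assumes "v \<in> V"
  shows "card (dihedral_orb a b v) = 2 * card (orb (b \<circ> a) v)"
  unfolding dihedral_orb_def
  using orb_disjoint[OF assms] finite_orb[OF ba_permutation] inj_a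
  by (simp add: card_Un_disjoint card_image inj_on_subset)

lemma dihedral_orb_common:
  assumes "a v = b v"
  shows "dihedral_orb a b v = {v, a v}"
proof -
  have "orb (b \<circ> a) v = {v}" using ba_fixed_iff assms by (intro orb_fixed) blast
  then show ?thesis by (auto simp: dihedral_orb_def)
qed

text \<open>A common edge is a whole component, so a component containing one vertex of disagreement
  consists of such vertices only.\<close>

lemma dihedral_orb_moved:
  assumes "a v \<noteq> b v" "x \<in> dihedral_orb a b v"
  shows "a x \<noteq> b x"
proof
  assume "a x = b x"
  then have "dihedral_orb a b v = {x, a x}" using dihedral_orb_common dihedral_orb_eq[OF assms(2)] by simp
  then have "v = x \<or> v = a x" using self_in_dihedral_orb[of v] by auto
  then show False using assms(1) \<open>a x = b x\<close> by (metis aa bb)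
qed

lemma card_orb_moved: "a v \<noteq> b v \<Longrightarrow> 2 \<le> card (orb (b \<circ> a) v)"
  using card_orb_ge_2[OF ba_permutation] ba_fixed_iff by blast

text \<open>These are the vertices of the non-common edges, that is, the points moved by
  \<open>b \<circ> a\<close>. They are to be distinguished from the points moved by a permutation
  carrying one matching to the other.\<close>

abbreviation "moved \<equiv> {v. a v \<noteq> b v}"

lemma moved_subset: "moved \<subseteq> V"
  using moved_in by blast

lemma finite_moved: "finite moved"
  using moved_subset fin by (rule finite_subset)

lemma matching_type_in_P2: "matching_type a b \<in> P2"
proof -
  have "2 \<le> card (dihedral_orb a b v) div 2" if "a v \<noteq> b v" for v
    using card_orb_moved[OF that] card_dihedral_orb[OF moved_in[OF that]] by simp
  then show ?thesis using finite_moved by (auto simp: matching_type_def P2_def)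
qed

lemma dbl_matching_type: "dbl (matching_type a b) = image_mset card (mset_set (dihedral_orb a b ` moved))"
proof -
  have "2 * (card C div 2) = card C" if C: "C \<in> dihedral_orb a b ` moved" for C
  proof -
    obtain v where v: "a v \<noteq> b v" "C = dihedral_orb a b v" using C by blast
    then show ?thesis using card_dihedral_orb[OF moved_in[OF v(1)]] by simp
  qed
  then show ?thesis
    unfolding dbl_def matching_type_def multiset.map_comp o_def
    using finite_moved by (intro image_mset_cong) simp
qed

lemma sum_dihedral_orb_cards:
  assumes "X \<subseteq> V" "\<And>v. v \<in> X \<Longrightarrow> dihedral_orb a b v \<subseteq> X"
  shows "sum_mset (image_mset card (mset_set (dihedral_orb a b ` X))) = card X"
proof -
  have "sum_mset (image_mset card (mset_set (dihedral_orb a b ` X))) = card (\<Union>(dihedral_orb a b ` X))"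
  proof (rule sum_card_disjoint_image)
    show "finite (dihedral_orb a b ` X)" using finite_subset[OF assms(1) fin] by simp
    show "finite C" if "C \<in> dihedral_orb a b ` X" for C using that finite_dihedral_orb by auto
    show "C \<inter> D = {}" if C: "C \<in> dihedral_orb a b ` X" "D \<in> dihedral_orb a b ` X" "C \<noteq> D" for C D
    proof -
      obtain v w where "C = dihedral_orb a b v" "D = dihedral_orb a b w" using C by blast
      then show ?thesis using dihedral_orb_cases[of v w] C(3) by simp
    qed
  qed
  also have "\<Union>(dihedral_orb a b ` X) = X"
    using assms(2) self_in_dihedral_orb by blast
  finally show ?thesis .
qed

lemma sum_dbl: "sum_mset (dbl \<nu>) = 2 * sum_mset \<nu>"
  by (induction \<nu>) (auto simp: dbl_def)

text \<open>The nontrivial components partition \<open>moved\<close> and each contributes half its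
  size, so j is the number of edges of either matching not shared with the other.\<close>

lemma two_sum_matching_type: "2 * sum_mset (matching_type a b) = card moved"
  unfolding sum_dbl[symmetric] dbl_matching_type
  by (rule sum_dihedral_orb_cards) (use moved_subset dihedral_orb_moved in blast)+

text \<open>Components inside \<open>moved\<close> contribute the doubled matching type; each
  remaining component is a common edge, of size 2, hence a doubled part 1. Counting vertices gives
  the number of these parts.\<close>

lemma dist_part_eq:
  "dist_part V (edges V a) (edges V b)
     = dbl (pad1 (matching_type a b) (card V div 2 - sum_mset (matching_type a b)))"
    (is "_ = dbl (pad1 _ ?r)")
  and sum_matching_type_le: "2 * sum_mset (matching_type a b) \<le> card V"
proof -
  let ?R = "V - moved"
  have im: "comp (edges V a \<union> edges V b) ` V = dihedral_orb a b ` moved \<union> dihedral_orb a b ` ?R"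
  proof -
    have "comp (edges V a \<union> edges V b) ` V = dihedral_orb a b ` V"
      by (rule image_cong[OF refl comp_eq_dihedral_orb])
    moreover have "V = moved \<union> ?R" using moved_subset by blast
    ultimately show ?thesis by (metis image_Un)
  qed
  have disj: "dihedral_orb a b ` moved \<inter> dihedral_orb a b ` ?R = {}"
  proof -
    have "dihedral_orb a b v \<noteq> dihedral_orb a b w" if "a v \<noteq> b v" "a w = b w" for v w
      using dihedral_orb_moved[OF that(1), of w] self_in_dihedral_orb[of w] that(2) by metis
    then show ?thesis by blast
  qed
  have two: "card C = 2" if C: "C \<in> dihedral_orb a b ` ?R" for C
  proof -
    obtain v where v: "v \<in> V" "a v = b v" "C = dihedral_orb a b v" using C by blast
    then show ?thesis using dihedral_orb_common[OF v(2)] a_neq[OF v(1)] by (auto simp: card_insert_if)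
  qed
  have R: "image_mset card (mset_set (dihedral_orb a b ` ?R)) = replicate_mset (card (dihedral_orb a b ` ?R)) 2"
  proof -
    have "image_mset card (mset_set (dihedral_orb a b ` ?R)) = image_mset (\<lambda>_. 2) (mset_set (dihedral_orb a b ` ?R))"
      by (rule image_mset_cong) (use fin two in simp)
    then show ?thesis by (simp add: image_mset_const_eq)
  qed
  have dp: "dist_part V (edges V a) (edges V b)
      = dbl (matching_type a b) + replicate_mset (card (dihedral_orb a b ` ?R)) 2"
    unfolding dist_part_def im dbl_matching_type R[symmetric]
    using disj finite_moved fin by (simp add: mset_set_Union)
  have "sum_mset (image_mset card (mset_set (dihedral_orb a b ` ?R))) = card ?R"
  proof (rule sum_dihedral_orb_cards)
    fix v assume v: "v \<in> ?R"
    then have "a (a v) = b (a v)" using aa[of v] bb[of v] by simp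
    then show "dihedral_orb a b v \<subseteq> ?R" using dihedral_orb_common[of v] v a_in b_in by simp
  qed blast
  then have cR: "2 * card (dihedral_orb a b ` ?R) = card ?R" by (simp add: R)
  have cV: "card V = card moved + card ?R"
    using card_Diff_subset[OF finite_moved moved_subset] card_mono[OF fin moved_subset] by simp
  show "2 * sum_mset (matching_type a b) \<le> card V"
    using cV two_sum_matching_type by presburger
  have "card (dihedral_orb a b ` ?R) = ?r" using cV cR two_sum_matching_type by presburger
  then show "dist_part V (edges V a) (edges V b) = dbl (pad1 (matching_type a b) ?r)"
    by (simp add: dp pad1_def dbl_def)
qed

end

lemma dbl_inject: "dbl \<mu> = dbl \<nu> \<longleftrightarrow> \<mu> = \<nu>"
  using multiset.inj_map[of "\<lambda>x::nat. 2 * x"] by (auto simp: dbl_def inj_def)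

lemma pad1_inject: "\<sigma> \<in> P2 \<Longrightarrow> \<tau> \<in> P2 \<Longrightarrow> pad1 \<sigma> r = pad1 \<tau> s \<Longrightarrow> \<sigma> = \<tau>"
  using filter_ge_2_pad1 by metis

subsection \<open>Isomorphism of pairs of matchings\<close>

text \<open>Write g = b a and h = d c. Sending g^i v to h^i w and a g^i v to c h^i w respects both
  involutions. It is well defined because the orbits of g and h have the same size, so the same
  exponents coincide on both sides.\<close>

lemma dihedral_orb_isomorphism:
  assumes "matching_pair V a b" "matching_pair W c d" "v \<in> V" "w \<in> W"
    and card: "card (dihedral_orb a b v) = card (dihedral_orb c d w)"
  shows "\<exists>\<phi>. bij_betw \<phi> (dihedral_orb a b v) (dihedral_orb c d w)
           \<and> (\<forall>x\<in>dihedral_orb a b v. \<phi> (a x) = c (\<phi> x) \<and> \<phi> (b x) = d (\<phi> x))"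
proof -
  interpret P: matching_pair V a b by fact
  interpret Q: matching_pair W c d by fact
  let ?g = "b \<circ> a" and ?h = "d \<circ> c"
  define m where "m = card (orb ?g v)"
  have m: "card (orb ?g v) = m" "card (orb ?h w) = m" "0 < m"
    using card P.card_dihedral_orb[OF assms(3)] Q.card_dihedral_orb[OF assms(4)] card_orb_pos[OF P.ba_permutation, of v]
    by (simp_all add: m_def)
  have g_eq: "(?g ^^ i) v = (?g ^^ j) v \<longleftrightarrow> (?h ^^ i) w = (?h ^^ j) w" for i j
    unfolding funpow_eq_iff_mod[OF P.ba_permutation] funpow_eq_iff_mod[OF Q.ba_permutation] m ..
  \<comment> \<open>Any exponent reaching \<open>x\<close> may be chosen, since \<open>g_eq\<close>
    makes the value independent of it. The two branches do not conflict because an orbit is disjoint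
    from its image under \<open>a\<close>.\<close>
  define \<phi> where "\<phi> x = (if x \<in> orb ?g v then (?h ^^ (SOME i. (?g ^^ i) v = x)) w
      else c ((?h ^^ (SOME i. a ((?g ^^ i) v) = x)) w))" for x
  have \<phi>1: "\<phi> ((?g ^^ i) v) = (?h ^^ i) w" for i
  proof -
    have "(?g ^^ (SOME j. (?g ^^ j) v = (?g ^^ i) v)) v = (?g ^^ i) v"
      by (rule someI[of _ i]) simp
    then show ?thesis using g_eq funpow_in_orb[of i ?g v] unfolding \<phi>_def by simp
  qed
  have \<phi>2: "\<phi> (a ((?g ^^ i) v)) = c ((?h ^^ i) w)" for i
  proof -
    have "a ((?g ^^ (SOME j. a ((?g ^^ j) v) = a ((?g ^^ i) v))) v) = a ((?g ^^ i) v)"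
      by (rule someI[of _ i]) simp
    then have "(?h ^^ (SOME j. a ((?g ^^ j) v) = a ((?g ^^ i) v))) w = (?h ^^ i) w"
      using g_eq P.a_eq_iff by blast
    moreover have "a ((?g ^^ i) v) \<notin> orb ?g v"
      using P.orb_disjoint[OF assms(3)] funpow_in_orb[of i ?g v] by blast
    ultimately show ?thesis unfolding \<phi>_def by simp
  qed
  have dihedral_orb: "dihedral_orb a b v = range (\<lambda>i. (?g ^^ i) v) \<union> range (\<lambda>i. a ((?g ^^ i) v))"
    "dihedral_orb c d w = range (\<lambda>i. (?h ^^ i) w) \<union> range (\<lambda>i. c ((?h ^^ i) w))"
    by (auto simp: dihedral_orb_def orb_def)
  have image: "\<phi> ` dihedral_orb a b v = dihedral_orb c d w"
    unfolding dihedral_orb image_Un image_image \<phi>1 \<phi>2 ..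
  then have "inj_on \<phi> (dihedral_orb a b v)"
    using card P.finite_dihedral_orb by (intro eq_card_imp_inj_on) auto
  with image have "bij_betw \<phi> (dihedral_orb a b v) (dihedral_orb c d w)" by (simp add: bij_betw_def)
  moreover have "\<phi> (a x) = c (\<phi> x) \<and> \<phi> (b x) = d (\<phi> x)" if x: "x \<in> dihedral_orb a b v" for x
  proof -
    consider i where "x = (?g ^^ i) v" | i where "x = a ((?g ^^ i) v)"
      using x unfolding dihedral_orb by blast
    then show ?thesis
    proof cases
      case (1 i)
      \<comment> \<open>To evaluate \<open>b x\<close>, write \<open>x\<close> as an image under
        \<open>b \<circ> a\<close>, so that \<open>b\<close> cancels. The exponent
        \<open>i + (m - 1)\<close> stands for i - 1 modulo m and avoids a separate case i =
        0.\<close>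
      have "\<exists>k. x = (?g ^^ Suc k) v"
      proof (intro exI)
        have "Suc (i + (m - 1)) mod m = i mod m" using m(3) by simp
        then show "x = (?g ^^ Suc (i + (m - 1))) v"
          using 1 funpow_eq_iff_mod[OF P.ba_permutation, of i v "Suc (i + (m - 1))"] m(1) by simp
      qed
      then obtain k where k: "x = (?g ^^ Suc k) v" by blast
      have "b x = a ((?g ^^ k) v)" using k P.bb by simp
      moreover have "\<phi> x = d (c ((?h ^^ k) w))" using \<phi>1[of "Suc k"] k by simp
      ultimately show ?thesis using 1 \<phi>1[of i] \<phi>2[of i] \<phi>2[of k] Q.bb by simp
    next
      case (2 i)
      have "b x = (?g ^^ Suc i) v" using 2 by simp
      then have "\<phi> (b x) = d (c ((?h ^^ i) w))" using \<phi>1[of "Suc i"] by simp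
      then show ?thesis using 2 \<phi>1[of i] \<phi>2[of i] P.aa Q.aa by simp
    qed
  qed
  ultimately show ?thesis by blast
qed

lemma (in matching_pair) dist_part_eq_dihedral_orb:
  "dist_part V (edges V a) (edges V b) = image_mset card (mset_set (dihedral_orb a b ` V))"
proof -
  have "comp (edges V a \<union> edges V b) ` V = dihedral_orb a b ` V"
    by (rule image_cong[OF refl comp_eq_dihedral_orb])
  then show ?thesis by (simp add: dist_part_def)
qed

text \<open>The distance records exactly the component sizes. Components are matched by size,
  isomorphisms between matched components are glued, and the result is extended to all naturals.
  Thus every count invariant under relabelling depends on the distance alone.\<close>

lemma matching_pairs_isomorphism:
  assumes "matching_pair V a b" "matching_pair W c d"
    and dist: "dist_part V (edges V a) (edges V b) = dist_part W (edges W c) (edges W d)"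
  shows "\<exists>\<Phi>. bij \<Phi> \<and> \<Phi> ` V = W \<and> (\<forall>v\<in>V. \<Phi> (a v) = c (\<Phi> v) \<and> \<Phi> (b v) = d (\<Phi> v))"
proof -
  interpret P: matching_pair V a b by fact
  interpret Q: matching_pair W c d by fact
  have "finite (dihedral_orb a b ` V)" "finite (dihedral_orb c d ` W)" using P.fin Q.fin by simp_all
  then obtain \<eta> where \<eta>: "bij_betw \<eta> (dihedral_orb a b ` V) (dihedral_orb c d ` W)"
      "\<forall>C\<in>dihedral_orb a b ` V. card (\<eta> C) = card C"
    using ex_bij_betw_of_image_mset_eq[of "dihedral_orb a b ` V" "dihedral_orb c d ` W" card card]
      dist[unfolded P.dist_part_eq_dihedral_orb Q.dist_part_eq_dihedral_orb] by auto
  have "\<forall>C\<in>dihedral_orb a b ` V. \<exists>\<phi>. bij_betw \<phi> C (\<eta> C) \<and> (\<forall>x\<in>C. \<phi> (a x) = c (\<phi> x) \<and> \<phi> (b x) = d (\<phi> x))"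
  proof
    fix C assume C: "C \<in> dihedral_orb a b ` V"
    then obtain v where v: "v \<in> V" "C = dihedral_orb a b v" by blast
    obtain w where w: "w \<in> W" "\<eta> C = dihedral_orb c d w" using bij_betwE[OF \<eta>(1)] C by blast
    show "\<exists>\<phi>. bij_betw \<phi> C (\<eta> C) \<and> (\<forall>x\<in>C. \<phi> (a x) = c (\<phi> x) \<and> \<phi> (b x) = d (\<phi> x))"
      using dihedral_orb_isomorphism[OF assms(1,2) v(1) w(1)] bspec[OF \<eta>(2) C] w(2) unfolding v(2) by simp
  qed
  then obtain \<psi> where \<psi>: "\<And>C. C \<in> dihedral_orb a b ` V \<Longrightarrow> bij_betw (\<psi> C) C (\<eta> C)"
      "\<And>C x. C \<in> dihedral_orb a b ` V \<Longrightarrow> x \<in> C \<Longrightarrow> \<psi> C (a x) = c (\<psi> C x) \<and> \<psi> C (b x) = d (\<psi> C x)"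
    by metis
  define \<phi> where "\<phi> x = \<psi> (dihedral_orb a b x) x" for x
  have in_eta: "\<phi> x \<in> \<eta> (dihedral_orb a b x)" if "x \<in> V" for x
    using \<psi>(1)[of "dihedral_orb a b x"] that P.self_in_dihedral_orb[of x] by (auto simp: \<phi>_def bij_betw_def)
  have eta_dihedral_orb: "\<exists>w\<in>W. \<eta> (dihedral_orb a b x) = dihedral_orb c d w" if "x \<in> V" for x
    using bij_betwE[OF \<eta>(1)] that by blast
  have "bij_betw \<phi> V W"
    unfolding bij_betw_def
  proof (intro conjI inj_onI subset_antisym subsetI)
    fix x y assume xy: "x \<in> V" "y \<in> V" "\<phi> x = \<phi> y"
    obtain w w' where w: "\<eta> (dihedral_orb a b x) = dihedral_orb c d w" "\<eta> (dihedral_orb a b y) = dihedral_orb c d w'"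
      using eta_dihedral_orb[OF xy(1)] eta_dihedral_orb[OF xy(2)] by blast
    have "\<phi> x \<in> dihedral_orb c d w" "\<phi> x \<in> dihedral_orb c d w'"
      using in_eta[OF xy(1)] in_eta[OF xy(2)] xy(3) w by simp_all
    then have "\<eta> (dihedral_orb a b x) = \<eta> (dihedral_orb a b y)"
      unfolding w using Q.dihedral_orb_eq[of "\<phi> x" w] Q.dihedral_orb_eq[of "\<phi> x" w'] by simp
    then have eq: "dihedral_orb a b x = dihedral_orb a b y"
      using inj_onD[OF bij_betw_imp_inj_on[OF \<eta>(1)]] xy(1,2) by blast
    then have "\<psi> (dihedral_orb a b x) x = \<psi> (dihedral_orb a b x) y" using xy(3) by (simp add: \<phi>_def)
    moreover have "inj_on (\<psi> (dihedral_orb a b x)) (dihedral_orb a b x)" using \<psi>(1) xy(1) bij_betw_def by blast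
    ultimately show "x = y"
      using inj_onD[OF _ _ P.self_in_dihedral_orb[of x] P.self_in_dihedral_orb[of y, folded eq]] by blast
  next
    fix y assume "y \<in> \<phi> ` V"
    then obtain x where x: "x \<in> V" "y = \<phi> x" by blast
    obtain w where "w \<in> W" "\<eta> (dihedral_orb a b x) = dihedral_orb c d w" using eta_dihedral_orb[OF x(1)] by blast
    then show "y \<in> W" using in_eta[OF x(1)] Q.dihedral_orb_in[of w] x(2) by simp
  next
    fix y assume y: "y \<in> W"
    have "dihedral_orb c d y \<in> \<eta> ` dihedral_orb a b ` V"
      unfolding bij_betw_imp_surj_on[OF \<eta>(1)] using y by (rule imageI)
    then obtain v where v: "v \<in> V" "dihedral_orb c d y = \<eta> (dihedral_orb a b v)" by blast
    have "\<psi> (dihedral_orb a b v) ` dihedral_orb a b v = dihedral_orb c d y"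
      using \<psi>(1)[of "dihedral_orb a b v"] v by (simp add: bij_betw_def)
    then obtain x where x: "x \<in> dihedral_orb a b v" "y = \<psi> (dihedral_orb a b v) x"
      using Q.self_in_dihedral_orb[of y] by blast
    then have "y = \<phi> x" by (simp add: \<phi>_def P.dihedral_orb_eq)
    then show "y \<in> \<phi> ` V" using P.dihedral_orb_in[OF v(1) x(1)] by blast
  qed
  then obtain \<Phi> where \<Phi>: "bij \<Phi>" "\<forall>v\<in>V. \<Phi> v = \<phi> v" using extend_bij_betw P.fin by blast
  have "\<Phi> ` V = W" using \<Phi>(2) \<open>bij_betw \<phi> V W\<close> by (simp add: bij_betw_def)
  moreover have "\<Phi> (a v) = c (\<Phi> v) \<and> \<Phi> (b v) = d (\<Phi> v)" if v: "v \<in> V" for v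
  proof -
    have "dihedral_orb a b (a v) = dihedral_orb a b v" "dihedral_orb a b (b v) = dihedral_orb a b v"
      using P.dihedral_orb_eq[OF P.a_in_dihedral_orb[OF P.self_in_dihedral_orb]] P.dihedral_orb_eq[OF P.b_in_dihedral_orb[OF P.self_in_dihedral_orb]]
      by simp_all
    then have "\<phi> (a v) = c (\<phi> v) \<and> \<phi> (b v) = d (\<phi> v)"
      using \<psi>(2)[of "dihedral_orb a b v" v] v P.self_in_dihedral_orb by (simp add: \<phi>_def)
    then show ?thesis using \<Phi>(2) v P.a_in P.b_in by simp
  qed
  ultimately show ?thesis using \<Phi>(1) by blast
qed

lemma matching_type_conj:
  assumes "bij \<Phi>"
  shows "matching_type (\<Phi> \<circ> a \<circ> inv \<Phi>) (\<Phi> \<circ> b \<circ> inv \<Phi>) = matching_type a b"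
proof -
  let ?a = "\<Phi> \<circ> a \<circ> inv \<Phi>" and ?b = "\<Phi> \<circ> b \<circ> inv \<Phi>"
  have inj: "inv \<Phi> (\<Phi> v) = v" for v using assms by (simp add: bij_is_inj inv_f_f)
  have "?b \<circ> ?a = \<Phi> \<circ> (b \<circ> a) \<circ> inv \<Phi>" by (simp add: fun_eq_iff inj)
  then have "dihedral_orb ?a ?b (\<Phi> v) = \<Phi> ` dihedral_orb a b v" for v
    by (simp add: dihedral_orb_def orb_conj[OF assms] image_Un image_image inj)
  moreover have "{v. ?a v \<noteq> ?b v} = \<Phi> ` {v. a v \<noteq> b v}"
    using moved_conj[OF assms, of a b] by simp
  ultimately have "dihedral_orb ?a ?b ` {v. ?a v \<noteq> ?b v} = (`) \<Phi> ` dihedral_orb a b ` {v. a v \<noteq> b v}"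
    by (simp add: image_image)
  then show ?thesis
    unfolding matching_type_def
    using image_mset_card_image[of \<Phi> "\<lambda>n. n div 2"] bij_is_inj[OF assms] by simp
qed

subsection \<open>Permutations carrying one matching to another\<close>

text \<open>Prescribing \<open>long_cycles\<close> rather than \<open>cycle_type\<close> keeps
  \<open>\<mu>\<close> unchanged when \<open>V\<close> is replaced by a smaller vertex set.\<close>

definition carriers :: "nat set \<Rightarrow> nat multiset \<Rightarrow> (nat \<Rightarrow> nat) \<Rightarrow> (nat \<Rightarrow> nat) \<Rightarrow> (nat \<Rightarrow> nat) set" where
  "carriers V \<mu> a b = {\<sigma>. \<sigma> permutes V \<and> long_cycles \<sigma> = \<mu> \<and> (\<forall>v\<in>V. \<sigma> (a v) = b (\<sigma> v))}"

lemma permutes_conj: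
  assumes "bij \<Phi>" "\<sigma> permutes V"
  shows "\<Phi> \<circ> \<sigma> \<circ> inv \<Phi> permutes \<Phi> ` V"
  unfolding permutes_def
proof (intro conjI allI impI)
  have surj: "\<Phi> (inv \<Phi> v) = v" for v using assms(1) by (simp add: bij_is_surj surj_f_inv_f)
  fix v
  show "(\<Phi> \<circ> \<sigma> \<circ> inv \<Phi>) v = v" if "v \<notin> \<Phi> ` V"
  proof -
    have "inv \<Phi> v \<notin> V" using that surj[of v] by force
    then show ?thesis using permutes_not_in[OF assms(2)] surj by simp
  qed
  have "bij (\<Phi> \<circ> \<sigma> \<circ> inv \<Phi>)"
    using assms by (intro bij_comp bij_imp_bij_inv permutes_bij)
  then show "\<exists>!w. (\<Phi> \<circ> \<sigma> \<circ> inv \<Phi>) w = v" by (metis bij_pointE)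
qed

lemma carriers_conj:
  assumes "bij \<Phi>" "\<And>v. v \<in> V \<Longrightarrow> \<Phi> (a v) = c (\<Phi> v)" "\<And>v. v \<in> V \<Longrightarrow> \<Phi> (b v) = d (\<Phi> v)"
    and a: "\<And>v. v \<in> V \<Longrightarrow> a v \<in> V"
    and \<sigma>: "\<sigma> \<in> carriers V \<mu> a b"
  shows "\<Phi> \<circ> \<sigma> \<circ> inv \<Phi> \<in> carriers (\<Phi> ` V) \<mu> c d"
proof -
  have inj: "inv \<Phi> (\<Phi> v) = v" for v using assms(1) by (simp add: bij_is_inj inv_f_f)
  have \<sigma>': "\<sigma> permutes V" "long_cycles \<sigma> = \<mu>" "\<And>v. v \<in> V \<Longrightarrow> \<sigma> (a v) = b (\<sigma> v)"
    using \<sigma> by (auto simp: carriers_def)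
  have "(\<Phi> \<circ> \<sigma> \<circ> inv \<Phi>) (c w) = d ((\<Phi> \<circ> \<sigma> \<circ> inv \<Phi>) w)" if w: "w \<in> \<Phi> ` V" for w
  proof -
    obtain v where v: "v \<in> V" "w = \<Phi> v" using w by blast
    have "\<sigma> v \<in> V" using permutes_in_image[OF \<sigma>'(1)] v by simp
    have "(\<Phi> \<circ> \<sigma> \<circ> inv \<Phi>) (c w) = \<Phi> (\<sigma> (a v))" using assms(2)[OF v(1)] v(2) inj[of "a v"] by simp
    also have "\<dots> = d (\<Phi> (\<sigma> v))" using assms(3)[OF \<open>\<sigma> v \<in> V\<close>] \<sigma>'(3)[OF v(1)] by simp
    finally show ?thesis using v(2) inj by simp
  qed
  then show ?thesis
    using permutes_conj[OF assms(1) \<sigma>'(1)] long_cycles_conj[OF assms(1)] \<sigma>'(2) by (simp add: carriers_def)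
qed

lemma card_carriers_conj:
  assumes \<Phi>: "bij \<Phi>" and W: "\<Phi> ` V = W"
    and ac: "\<And>v. v \<in> V \<Longrightarrow> \<Phi> (a v) = c (\<Phi> v)" and bd: "\<And>v. v \<in> V \<Longrightarrow> \<Phi> (b v) = d (\<Phi> v)"
    and a: "\<And>v. v \<in> V \<Longrightarrow> a v \<in> V"
  shows "card (carriers V \<mu> a b) = card (carriers W \<mu> c d)"
proof -
  have inj: "inv \<Phi> (\<Phi> v) = v" for v using \<Phi> by (simp add: bij_is_inj inv_f_f)
  have surj: "\<Phi> (inv \<Phi> v) = v" for v using \<Phi> by (simp add: bij_is_surj surj_f_inv_f)
  have inv: "bij (inv \<Phi>)" "inv (inv \<Phi>) = \<Phi>" "inv \<Phi> ` W = V"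
    using \<Phi> W by (auto simp: bij_imp_bij_inv inv_inv_eq image_image inj simp flip: W)
  have inv_in: "inv \<Phi> w \<in> V" if "w \<in> W" for w using inv(3) that by blast
  have ca: "inv \<Phi> (c w) = a (inv \<Phi> w)" if "w \<in> W" for w
    using ac[OF inv_in[OF that]] inj[of "a (inv \<Phi> w)"] by (simp add: surj)
  have db: "inv \<Phi> (d w) = b (inv \<Phi> w)" if "w \<in> W" for w
    using bd[OF inv_in[OF that]] inj[of "b (inv \<Phi> w)"] by (simp add: surj)
  have c: "c w \<in> W" if "w \<in> W" for w
    using ac[OF inv_in[OF that]] a[OF inv_in[OF that]] W surj by (metis imageI)
  have "bij_betw (\<lambda>\<sigma>. \<Phi> \<circ> \<sigma> \<circ> inv \<Phi>) (carriers V \<mu> a b) (carriers W \<mu> c d)"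
  proof (rule bij_betw_byWitness[of _ "\<lambda>\<sigma>. inv \<Phi> \<circ> \<sigma> \<circ> \<Phi>"])
    show "\<forall>\<sigma>\<in>carriers V \<mu> a b. inv \<Phi> \<circ> (\<Phi> \<circ> \<sigma> \<circ> inv \<Phi>) \<circ> \<Phi> = \<sigma>" by (simp add: fun_eq_iff inj)
    show "\<forall>\<sigma>\<in>carriers W \<mu> c d. \<Phi> \<circ> (inv \<Phi> \<circ> \<sigma> \<circ> \<Phi>) \<circ> inv \<Phi> = \<sigma>" by (simp add: fun_eq_iff surj)
    show "(\<lambda>\<sigma>. \<Phi> \<circ> \<sigma> \<circ> inv \<Phi>) ` carriers V \<mu> a b \<subseteq> carriers W \<mu> c d"
      using carriers_conj[where a = a and b = b and c = c and d = d, OF \<Phi> ac bd a] W by blast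
    show "(\<lambda>\<sigma>. inv \<Phi> \<circ> \<sigma> \<circ> \<Phi>) ` carriers W \<mu> c d \<subseteq> carriers V \<mu> a b"
      using carriers_conj[where a = c and b = d and c = a and d = b, OF inv(1) ca db c, unfolded inv(2,3)] by blast
  qed
  then show ?thesis by (rule bij_betw_same_card)
qed

lemma card_carriers_dist_part:
  assumes "matching_pair V a b" "matching_pair W c d"
    and "dist_part V (edges V a) (edges V b) = dist_part W (edges W c) (edges W d)"
  shows "card (carriers V \<mu> a b) = card (carriers W \<mu> c d)"
proof -
  interpret P: matching_pair V a b by fact
  obtain \<Phi> where "bij \<Phi>" "\<Phi> ` V = W" "\<forall>v\<in>V. \<Phi> (a v) = c (\<Phi> v) \<and> \<Phi> (b v) = d (\<Phi> v)"
    using matching_pairs_isomorphism[OF assms] by blast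
  then show ?thesis using P.a_in by (intro card_carriers_conj) auto
qed

section \<open>The numbers m(rho, 2 sigma) on an arbitrary vertex set\<close>

lemma finite_verts: "finite (verts s)" and card_verts: "card (verts s) = 2 * s"
  by (auto simp: verts_def)

lemma Ist_edges: "\<exists>\<iota>. fpf_involution (verts s) \<iota> \<and> Ist s = edges (verts s) \<iota>"
proof (rule perfect_matching_edges)
  have eq: "e = {v, if v \<le> s then s + v else v - s}" if "e \<in> Ist s" "v \<in> e" for e v
    using that by (auto simp: Ist_def)
  have "\<exists>!e. e \<in> Ist s \<and> v \<in> e" if v: "v \<in> verts s" for v
  proof (rule ex1I[of _ "{v, if v \<le> s then s + v else v - s}"])
    show "{v, if v \<le> s then s + v else v - s} \<in> Ist s \<and> v \<in> {v, if v \<le> s then s + v else v - s}"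
    proof (cases "v \<le> s")
      case True
      then show ?thesis using v unfolding Ist_def verts_def by auto
    next
      case False
      then have "{v, v - s} = {v - s, s + (v - s)}" "v - s \<in> {1..s}" using v by (auto simp: verts_def)
      then show ?thesis using False unfolding Ist_def by auto
    qed
  qed (use eq in blast)
  moreover have "card e = 2 \<and> e \<subseteq> verts s" if "e \<in> Ist s" for e
  proof -
    obtain i where "1 \<le> i" "i \<le> s" "e = {i, s + i}" using \<open>e \<in> Ist s\<close> by (auto simp: Ist_def)
    then show ?thesis by (auto simp: verts_def)
  qed
  ultimately show "Ist s \<in> perfect_matchings (verts s)" by (simp add: perfect_matchings_def)
qed

lemma matching_pair_diag: "finite V \<Longrightarrow> fpf_involution V a \<Longrightarrow> matching_pair V a a"
  by unfold_locales

text \<open>A matching paired with itself has all components of size 2, so any two single matchings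
  on sets of equal size are isomorphic; \<open>b\<close> is transported along such an isomorphism.
  This provides a witness for the choice made in \<open>mcount\<close>.\<close>

lemma ex_matching_at_distance:
  assumes "matching_pair V a b" "fpf_involution W \<iota>" "finite W" "card V = card W"
  shows "\<exists>c. fpf_involution W c \<and> dist_part W (edges W \<iota>) (edges W c) = dist_part V (edges V a) (edges V b)"
proof -
  interpret P: matching_pair V a b by fact
  interpret PP: matching_pair V a a using matching_pair_diag P.fin P.fpf_involution_a by blast
  interpret QQ: matching_pair W \<iota> \<iota> using matching_pair_diag assms by blast
  have "dist_part V (edges V a) (edges V a) = dist_part W (edges W \<iota>) (edges W \<iota>)"
    unfolding PP.dist_part_eq QQ.dist_part_eq by (simp add: matching_type_def assms(4))
  then obtain \<Phi> where \<Phi>: "bij \<Phi>" "\<Phi> ` V = W" "\<forall>v\<in>V. \<Phi> (a v) = \<iota> (\<Phi> v)"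
    using matching_pairs_isomorphism[OF PP.matching_pair_axioms QQ.matching_pair_axioms] by blast
  have \<iota>: "\<Phi> \<circ> a \<circ> inv \<Phi> = \<iota>"
  proof
    fix w
    have inj: "inv \<Phi> (\<Phi> v) = v" for v using \<Phi>(1) by (simp add: bij_is_inj inv_f_f)
    have fpf_involution: "fpf_involution W (\<Phi> \<circ> a \<circ> inv \<Phi>)" using fpf_involution_conj[OF \<Phi>(1) P.fpf_involution_a] \<Phi>(2) by simp
    show "(\<Phi> \<circ> a \<circ> inv \<Phi>) w = \<iota> w"
    proof (cases "w \<in> W")
      case True
      then obtain v where "v \<in> V" "w = \<Phi> v" using \<Phi>(2) by blast
      then show ?thesis using \<Phi>(3) by (simp add: inj)
    next
      case False
      then show ?thesis using fpf_involution_not_in[OF fpf_involution] fpf_involution_not_in[OF assms(2)] by metis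
    qed
  qed
  define c where "c = \<Phi> \<circ> b \<circ> inv \<Phi>"
  have c: "fpf_involution W c" using fpf_involution_conj[OF \<Phi>(1) P.fpf_involution_b] \<Phi>(2) by (simp add: c_def)
  interpret Q: matching_pair W \<iota> c by unfold_locales (use assms c in auto)
  have "matching_type \<iota> c = matching_type a b"
    using matching_type_conj[OF \<Phi>(1), of a b] \<iota> by (simp add: c_def)
  then show ?thesis
    using c assms(4) Q.dist_part_eq P.dist_part_eq by metis
qed

text \<open>Whichever matching \<open>mcount\<close> selects, it forms with \<open>Ist s\<close> a
  pair isomorphic to \<open>a\<close>, \<open>b\<close>, and conjugation preserves the count. The
  set \<open>V\<close> is arbitrary because the lemma is later applied to the vertices selected by a
  set of common edges.\<close>

lemma mcount_eq_card_carriers: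
  assumes "matching_pair V a b" "card V = 2 * s" "\<mu> \<in> P2"
  shows "mcount s (pad1 \<mu> (2 * s - sum_mset \<mu>)) (pad1 (matching_type a b) (s - sum_mset (matching_type a b)))
    = card (carriers V \<mu> a b)"
proof -
  interpret P: matching_pair V a b by fact
  obtain \<iota> where \<iota>: "fpf_involution (verts s) \<iota>" "Ist s = edges (verts s) \<iota>" using Ist_edges by blast
  let ?\<delta> = "dbl (pad1 (matching_type a b) (s - sum_mset (matching_type a b)))"
  have \<delta>: "dist_part V (edges V a) (edges V b) = ?\<delta>"
    unfolding P.dist_part_eq assms(2) by simp
  obtain c where "fpf_involution (verts s) c" "dist_part (verts s) (Ist s) (edges (verts s) c) = ?\<delta>"
    using ex_matching_at_distance[OF assms(1) \<iota>(1) finite_verts] \<delta> \<iota>(2) assms(2) card_verts by metis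
  then have ex: "\<exists>A. A \<in> perfect_matchings (verts s) \<and> dist_part (verts s) (Ist s) A = ?\<delta>"
    using edges_perfect_matching by blast
  define A where "A = (SOME A. A \<in> perfect_matchings (verts s) \<and> dist_part (verts s) (Ist s) A = ?\<delta>)"
  have A: "A \<in> perfect_matchings (verts s)" "dist_part (verts s) (Ist s) A = ?\<delta>"
    using someI_ex[OF ex] by (simp_all add: A_def)
  obtain c where c: "fpf_involution (verts s) c" "A = edges (verts s) c" using perfect_matching_edges A(1) by blast
  have pair: "matching_pair (verts s) \<iota> c" by unfold_locales (use \<iota> c finite_verts in auto)
  have "{\<pi>. \<pi> permutes verts s \<and> cycle_type (verts s) \<pi> = pad1 \<mu> (2 * s - sum_mset \<mu>)
      \<and> relabel \<pi> (Ist s) = A} = carriers (verts s) \<mu> \<iota> c"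
    unfolding carriers_def \<iota>(2) c(2)
    using cycle_type_eq_pad1_iff[OF finite_verts _ assms(3), of _ s] relabel_edges_eq_iff[OF _ \<iota>(1) c(1)]
    by (auto simp: card_verts)
  then have "mcount s (pad1 \<mu> (2 * s - sum_mset \<mu>)) (pad1 (matching_type a b) (s - sum_mset (matching_type a b)))
      = card (carriers (verts s) \<mu> \<iota> c)"
    by (simp add: mcount_def A_def)
  also have "\<dots> = card (carriers V \<mu> a b)"
    using card_carriers_dist_part[OF assms(1) pair] \<delta> A(2) \<iota>(2) c(2) by simp
  finally show ?thesis .
qed

subsection \<open>Moved edges and Moebius inversion\<close>

lemma sum_Pow_card:
  fixes \<phi> :: "nat \<Rightarrow> int"
  assumes "finite S"
  shows "(\<Sum>U\<in>Pow S. \<phi> (card U)) = (\<Sum>u\<le>card S. int (card S choose u) * \<phi> u)"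
proof -
  have "(\<Sum>U\<in>Pow S. \<phi> (card U)) = (\<Sum>u\<le>card S. \<Sum>U\<in>{U\<in>Pow S. card U = u}. \<phi> (card U))"
    by (rule sum.group[symmetric]) (use assms card_mono in auto)
  also have "\<dots> = (\<Sum>u\<le>card S. int (card S choose u) * \<phi> u)"
  proof (rule sum.cong)
    fix u
    have "(\<Sum>U\<in>{U\<in>Pow S. card U = u}. \<phi> (card U)) = (\<Sum>U\<in>{U\<in>Pow S. card U = u}. \<phi> u)"
      by (rule sum.cong) auto
    also have "\<dots> = int (card {U. U \<subseteq> S \<and> card U = u}) * \<phi> u" by simp
    finally show "(\<Sum>U\<in>{U\<in>Pow S. card U = u}. \<phi> (card U)) = int (card S choose u) * \<phi> u"
      using n_subsets[OF assms] by simp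
  qed simp
  finally show ?thesis .
qed

lemma finite_carriers: "finite V \<Longrightarrow> finite (carriers V \<mu> a b)"
  by (rule finite_subset[OF _ finite_permutations]) (auto simp: carriers_def)

lemma carriers_support:
  assumes "finite V" "\<sigma> \<in> carriers V \<mu> a b"
  shows "card {v. \<sigma> v \<noteq> v} = sum_mset \<mu>" "{v. \<sigma> v \<noteq> v} \<subseteq> V"
proof -
  have \<sigma>: "\<sigma> permutes V" "long_cycles \<sigma> = \<mu>" using assms(2) by (auto simp: carriers_def)
  then have "permutation \<sigma>" using assms(1) permutation_permutes by blast
  then show "card {v. \<sigma> v \<noteq> v} = sum_mset \<mu>" using sum_long_cycles \<sigma>(2) by metis
  show "{v. \<sigma> v \<noteq> v} \<subseteq> V" using permutes_not_in[OF \<sigma>(1)] by blast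
qed

definition restrict_perm :: "nat set \<Rightarrow> (nat \<Rightarrow> nat) \<Rightarrow> nat \<Rightarrow> nat" where
  "restrict_perm W f v = (if v \<in> W then f v else v)"

context matching_pair
begin

definition common :: "nat set set" where
  "common = (\<lambda>v. {v, a v}) ` (V - moved)"

text \<open>One moved endpoint is required here; for a permutation in
  \<open>carriers V \<mu> a b\<close> the other endpoint is then moved as well.\<close>

definition touched :: "(nat \<Rightarrow> nat) \<Rightarrow> nat set set" where
  "touched \<sigma> = {e \<in> common. \<exists>v\<in>e. \<sigma> v \<noteq> v}"

lemma a_moved: "a v \<in> moved \<longleftrightarrow> v \<in> moved"
proof -
  have "a (a v) = b (a v) \<longleftrightarrow> a v = b v" using aa[of v] bb[of v] bb[of "a v"] by metis
  then show ?thesis by simp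
qed

lemma common_eq: "e \<in> common \<Longrightarrow> v \<in> e \<Longrightarrow> e = {v, a v} \<and> v \<in> V - moved"
proof -
  assume e: "e \<in> common" "v \<in> e"
  then obtain w where w: "w \<in> V" "w \<notin> moved" "e = {w, a w}" unfolding common_def by blast
  show "e = {v, a v} \<and> v \<in> V - moved"
  proof (cases "v = w")
    case False
    then have "v = a w" using e(2) w(3) by blast
    then show ?thesis using w a_in[of w] a_moved[of w] aa[of w] by (simp add: insert_commute)
  qed (use w in blast)
qed

lemma common_in: "e \<in> common \<Longrightarrow> e \<subseteq> V - moved"
  using common_eq by blast

lemma finite_common: "finite common"
  using fin by (simp add: common_def)

lemma card_Union_common:
  assumes "S \<subseteq> common"
  shows "card (\<Union>S) = 2 * card S"
proof -
  have two: "card e = 2" if e: "e \<in> common" for e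
  proof -
    obtain v where "v \<in> V" "e = {v, a v}" using e unfolding common_def by blast
    then show ?thesis using a_neq[of v] by (simp add: card_insert_if eq_commute[of v])
  qed
  have "card (\<Union>S) = sum card S"
  proof (rule card_Union_disjoint)
    show "pairwise disjnt S" using assms common_eq unfolding pairwise_def disjnt_def by blast
    show "finite e" if "e \<in> S" for e using two[of e] that assms card.infinite by fastforce
  qed
  also have "\<dots> = (\<Sum>e\<in>S. 2)" using two assms by (intro sum.cong) auto
  finally show ?thesis by simp
qed

lemma card_moved_Union:
  assumes "S \<subseteq> common"
  shows "card (moved \<union> \<Union>S) = 2 * (sum_mset (matching_type a b) + card S)"
proof -
  have "finite (\<Union>S)" using assms common_in by (intro finite_subset[OF _ fin]) blast
  moreover have "moved \<inter> \<Union>S = {}" using assms common_in by blast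
  ultimately show ?thesis
    using finite_moved card_Union_common[OF assms] two_sum_matching_type
    by (simp add: card_Un_disjoint)
qed

lemma card_common: "card V = 2 * (sum_mset (matching_type a b) + card common)"
proof -
  have "moved \<union> \<Union>common = V"
  proof
    show "moved \<union> \<Union>common \<subseteq> V" using moved_subset common_in by blast
    show "V \<subseteq> moved \<union> \<Union>common" unfolding common_def by blast
  qed
  then show ?thesis using card_moved_Union[of common] by simp
qed

text \<open>If \<sigma> fixes v and a v, then \<sigma> (a v) = b (\<sigma> v) gives a v = b v, so a
  non-common edge cannot be fixed at both ends. On a common edge the same relation shows that fixing
  one end fixes the other. The last two claims are kept for the case of equality.\<close>

lemma touched_bound:
  assumes "\<sigma> \<in> carriers V \<mu> a b"
  shows "sum_mset (matching_type a b) + 2 * card (touched \<sigma>) \<le> sum_mset \<mu>"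
    and "2 * card ({v. \<sigma> v \<noteq> v} \<inter> moved) \<ge> card moved"
    and "v \<in> moved \<Longrightarrow> \<sigma> v \<noteq> v \<or> \<sigma> (a v) \<noteq> a v"
proof -
  let ?D = "{v. \<sigma> v \<noteq> v}"
  have \<sigma>: "\<sigma> (a v) = b (\<sigma> v)" if "v \<in> V" for v using assms that by (auto simp: carriers_def)
  have finD: "finite ?D" using carriers_support(2)[OF fin assms] fin finite_subset by blast
  show moves: "\<sigma> v \<noteq> v \<or> \<sigma> (a v) \<noteq> a v" if "v \<in> moved" for v
  proof (rule ccontr)
    assume "\<not> (\<sigma> v \<noteq> v \<or> \<sigma> (a v) \<noteq> a v)"
    moreover have "a v \<noteq> b v" "v \<in> V" using that moved_in by simp_all
    ultimately show False using \<sigma>[of v] by simp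
  qed
  have "moved \<subseteq> (?D \<inter> moved) \<union> a ` (?D \<inter> moved)"
  proof
    fix v assume v: "v \<in> moved"
    show "v \<in> (?D \<inter> moved) \<union> a ` (?D \<inter> moved)"
    proof (cases "\<sigma> v = v")
      case True
      then have "a v \<in> ?D \<inter> moved" using moves[OF v] a_moved v by blast
      then have "a (a v) \<in> a ` (?D \<inter> moved)" by (rule imageI)
      then show ?thesis unfolding aa by (rule UnI2)
    qed (use v in blast)
  qed
  then have "card moved \<le> card ((?D \<inter> moved) \<union> a ` (?D \<inter> moved))"
    using finD by (intro card_mono) auto
  also have "\<dots> \<le> card (?D \<inter> moved) + card (?D \<inter> moved)"
    using finD card_image_le[of "?D \<inter> moved" a] card_Un_le[of "?D \<inter> moved" "a ` (?D \<inter> moved)"] by simp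
  finally show half: "2 * card (?D \<inter> moved) \<ge> card moved" by simp
  have sub: "touched \<sigma> \<subseteq> common" by (auto simp: touched_def)
  have "\<Union>(touched \<sigma>) \<subseteq> ?D - moved"
  proof
    fix v assume "v \<in> \<Union>(touched \<sigma>)"
    then obtain e w where e: "e \<in> common" "v \<in> e" "w \<in> e" "\<sigma> w \<noteq> w" unfolding touched_def by blast
    have v: "v \<in> V" "a v = b v" "w \<in> {v, a v}" using common_eq[OF e(1,2)] e(3) by simp_all
    have "\<sigma> v \<noteq> v"
    proof
      assume "\<sigma> v = v"
      then have "\<sigma> (a v) = a v" using \<sigma>[OF v(1)] v(2) by simp
      then show False using \<open>\<sigma> v = v\<close> v(3) e(4) by blast
    qed
    then show "v \<in> ?D - moved" using v(2) by simp
  qed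
  then have "2 * card (touched \<sigma>) \<le> card (?D - moved)"
    using card_mono[of "?D - moved" "\<Union>(touched \<sigma>)"] finD card_Union_common[OF sub] by simp
  moreover have "card ?D = card (?D \<inter> moved) + card (?D - moved)"
    using card_Int_Diff[OF finD] by blast
  ultimately show "sum_mset (matching_type a b) + 2 * card (touched \<sigma>) \<le> sum_mset \<mu>"
    using half two_sum_matching_type carriers_support(1)[OF fin assms] by simp
qed

section \<open>Restriction to the vertices selected by a set of common edges\<close>

context
  fixes S assumes S: "S \<subseteq> common"
begin

abbreviation "active \<equiv> moved \<union> \<Union>S"

lemma active_subset: "active \<subseteq> V"
  using moved_subset common_in S by blast

lemma not_active: "v \<notin> active \<Longrightarrow> a v = b v"
  by blast

lemma a_active: "a v \<in> active \<longleftrightarrow> v \<in> active"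
proof -
  have imp: "a v \<in> active" if v: "v \<in> active" for v
    using v
  proof
    assume "v \<in> moved"
    then show ?thesis using a_moved[of v] by blast
  next
    assume "v \<in> \<Union>S"
    then obtain e where "e \<in> S" "v \<in> e" by blast
    then show ?thesis using common_eq[of e v] S by blast
  qed
  show ?thesis using imp[of v] imp[of "a v"] unfolding aa by (rule iffI[rotated])
qed

lemma b_active: "b v \<in> active \<longleftrightarrow> v \<in> active"
proof (cases "a v = b v")
  case True
  show ?thesis unfolding True[symmetric] by (rule a_active)
next
  case False
  then have "v \<in> active" by simp
  moreover have "a (b v) \<noteq> b (b v)" using False aa[of "b v"] bb[of v] by metis
  then have "b v \<in> active" by simp
  ultimately show ?thesis by (intro iffI)
qed

lemma fpf_involution_restrict_perm:
  assumes "fpf_involution V f" "\<And>v. f v \<in> active \<longleftrightarrow> v \<in> active"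
  shows "fpf_involution active (restrict_perm active f)"
proof -
  have invol: "restrict_perm active f (restrict_perm active f v) = v" for v
    using assms(2)[of v] fpf_involution_inv[OF assms(1), of v] unfolding restrict_perm_def by presburger
  moreover have "\<exists>!w. restrict_perm active f w = v" for v
  proof (rule ex1I[of _ "restrict_perm active f v"])
    show "restrict_perm active f (restrict_perm active f v) = v" by (rule invol)
    show "w = restrict_perm active f v" if "restrict_perm active f w = v" for w using invol[of w] that by simp
  qed
  moreover have "restrict_perm active f v = v" if "v \<notin> active" for v using that by (simp only: restrict_perm_def if_False)
  moreover have "restrict_perm active f v \<noteq> v" if v: "v \<in> active" for v
    using v active_subset fpf_involution_neq[OF assms(1), of v] unfolding restrict_perm_def if_P[OF v] by blast
  ultimately show ?thesis unfolding fpf_involution_def permutes_def by blast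
qed

lemma matching_pair_restrict_perm: "matching_pair active (restrict_perm active a) (restrict_perm active b)"
  using fpf_involution_restrict_perm[OF fpf_involution_a a_active] fpf_involution_restrict_perm[OF fpf_involution_b b_active] finite_subset[OF active_subset fin]
  by unfold_locales

text \<open>Only common edges are dropped, and these do not enter the matching type. Outside
  \<open>active\<close> the two partner maps agree, so \<open>b \<circ> a\<close> is already the
  identity there and the product is unchanged.\<close>

lemma matching_type_restrict_perm: "matching_type (restrict_perm active a) (restrict_perm active b) = matching_type a b"
proof -
  have ba: "restrict_perm active b \<circ> restrict_perm active a = b \<circ> a"
  proof
    fix v
    show "(restrict_perm active b \<circ> restrict_perm active a) v = (b \<circ> a) v"
    proof (cases "v \<in> active")
      case True
      then show ?thesis using a_active[of v] unfolding restrict_perm_def comp_apply by presburger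
    next
      case False
      then show ?thesis using not_active[OF False] bb[of v] unfolding restrict_perm_def comp_apply by presburger
    qed
  qed
  have moved: "{v. restrict_perm active a v \<noteq> restrict_perm active b v} = moved" unfolding restrict_perm_def by auto
  have "dihedral_orb (restrict_perm active a) (restrict_perm active b) v = dihedral_orb a b v" if v: "v \<in> moved" for v
  proof -
    have "orb (b \<circ> a) v \<subseteq> moved"
      using dihedral_orb_moved[of v] v unfolding dihedral_orb_def by blast
    then have "restrict_perm active a ` orb (b \<circ> a) v = a ` orb (b \<circ> a) v"
      by (intro image_cong) (auto simp: restrict_perm_def)
    then show ?thesis unfolding dihedral_orb_def ba by simp
  qed
  then have "dihedral_orb (restrict_perm active a) (restrict_perm active b) ` moved = dihedral_orb a b ` moved" by (intro image_cong) auto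
  then show ?thesis unfolding matching_type_def moved by simp
qed

text \<open>A vertex of \<open>V\<close> outside \<open>active\<close> lies on a common edge not in
  \<open>S\<close>, so fixing all such vertices is the same as touching only edges of
  \<open>S\<close>. A constrained count on \<open>V\<close> thus becomes an unconstrained count on
  fewer vertices.\<close>

lemma carriers_restrict_perm: "carriers active \<mu> (restrict_perm active a) (restrict_perm active b) = {\<sigma> \<in> carriers V \<mu> a b. touched \<sigma> \<subseteq> S}"
proof (intro subset_antisym subsetI)
  fix \<sigma> assume "\<sigma> \<in> carriers active \<mu> (restrict_perm active a) (restrict_perm active b)"
  then have \<sigma>: "\<sigma> permutes active" "long_cycles \<sigma> = \<mu>"
      "\<And>v. v \<in> active \<Longrightarrow> \<sigma> (restrict_perm active a v) = restrict_perm active b (\<sigma> v)"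
    unfolding carriers_def by blast+
  have "\<sigma> (a v) = b (\<sigma> v)" for v
  proof (cases "v \<in> active")
    case True
    then show ?thesis using \<sigma>(3)[of v] permutes_in_image[OF \<sigma>(1), of v] unfolding restrict_perm_def by presburger
  next
    case False
    then have "a v \<notin> active" using a_active by blast
    then show ?thesis
      using False permutes_not_in[OF \<sigma>(1) False] permutes_not_in[OF \<sigma>(1) \<open>a v \<notin> active\<close>] not_active[OF False] by simp
  qed
  moreover have "touched \<sigma> \<subseteq> S"
  proof
    fix e assume "e \<in> touched \<sigma>"
    then obtain v where e: "e \<in> common" "v \<in> e" "\<sigma> v \<noteq> v" unfolding touched_def by blast
    then have "v \<in> active" using permutes_not_in[OF \<sigma>(1)] by blast
    then obtain e' where e': "e' \<in> S" "v \<in> e'" using common_eq[OF e(1,2)] by blast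
    then have "e' = e" using common_eq[OF e(1,2)] common_eq[of e' v] S by blast
    then show "e \<in> S" using e' by blast
  qed
  ultimately show "\<sigma> \<in> {\<sigma> \<in> carriers V \<mu> a b. touched \<sigma> \<subseteq> S}"
    using permutes_subset[OF \<sigma>(1) active_subset] \<sigma>(2) unfolding carriers_def by blast
next
  fix \<sigma> assume "\<sigma> \<in> {\<sigma> \<in> carriers V \<mu> a b. touched \<sigma> \<subseteq> S}"
  then have \<sigma>: "\<sigma> permutes V" "long_cycles \<sigma> = \<mu>"
      "\<And>v. v \<in> V \<Longrightarrow> \<sigma> (a v) = b (\<sigma> v)" "touched \<sigma> \<subseteq> S"
    unfolding carriers_def by blast+
  have "\<sigma> v = v" if v: "v \<in> V - active" for v
  proof (rule ccontr)
    assume "\<sigma> v \<noteq> v"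
    moreover have "{v, a v} \<in> common" using v unfolding common_def by blast
    ultimately have "{v, a v} \<in> S" using \<sigma>(4) unfolding touched_def by blast
    then show False using v by blast
  qed
  then have active: "\<sigma> permutes active" using permutes_superset[OF \<sigma>(1)] by blast
  moreover have "\<sigma> (restrict_perm active a v) = restrict_perm active b (\<sigma> v)" if v: "v \<in> active" for v
    using v \<sigma>(3)[of v] active_subset permutes_in_image[OF active, of v] unfolding restrict_perm_def by auto
  ultimately show "\<sigma> \<in> carriers active \<mu> (restrict_perm active a) (restrict_perm active b)"
    using \<sigma>(2) unfolding carriers_def by blast
qed

end

text \<open>The restricted pair has 2(j + |S|) vertices and the same matching type, so the count
  depends on \<open>S\<close> only through its size.\<close>

lemma card_touched_subset:
  assumes "\<mu> \<in> P2" "S \<subseteq> common" and s: "s = sum_mset (matching_type a b) + card S"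
  shows "mcount s (pad1 \<mu> (2 * s - sum_mset \<mu>)) (pad1 (matching_type a b) (s - sum_mset (matching_type a b)))
    = card {\<sigma> \<in> carriers V \<mu> a b. touched \<sigma> \<subseteq> S}"
  using mcount_eq_card_carriers[OF matching_pair_restrict_perm[OF assms(2)] _ assms(1), of s]
    card_moved_Union[OF assms(2)] matching_type_restrict_perm[OF assms(2)] carriers_restrict_perm[OF assms(2), of \<mu>] s
  by simp

lemma card_carriers_eq_zeta:
  assumes \<mu>: "\<mu> \<in> P2" and n: "card V = 2 * n"
    and less: "sum_mset (matching_type a b) < sum_mset \<mu>"
  shows "rat_of_nat (card (carriers V \<mu> a b)) = zeta (matching_type a b) \<mu> (of_nat (2 * n))"
proof -
  let ?\<tau> = "matching_type a b" and ?K = "carriers V \<mu> a b"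
  define j where "j = sum_mset ?\<tau>"
  define k where "k = sum_mset \<mu>"
  define M where "M s = int (mcount s (pad1 \<mu> (2 * s - k)) (pad1 ?\<tau> (s - j)))" for s
  define t where "t = card common"
  have n_eq: "n = j + t" using card_common n by (simp add: j_def t_def)
  define f where "f S = int (card {\<sigma> \<in> ?K. touched \<sigma> = S})" for S
  have finK: "finite ?K" using finite_carriers[OF fin] .
  have sum_f: "(\<Sum>U\<in>Pow S. f U) = int (card {\<sigma> \<in> ?K. touched \<sigma> \<subseteq> S})" if "finite S" for S
  proof -
    let ?A = "{\<sigma> \<in> ?K. touched \<sigma> \<subseteq> S}"
    have "(\<Sum>U\<in>Pow S. \<Sum>\<sigma>\<in>{\<sigma> \<in> ?A. touched \<sigma> = U}. 1) = (\<Sum>\<sigma>\<in>?A. 1 :: int)"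
      by (rule sum.group) (use finK that in auto)
    moreover have "(\<Sum>\<sigma>\<in>{\<sigma> \<in> ?A. touched \<sigma> = U}. 1) = f U" if "U \<in> Pow S" for U
    proof -
      have "{\<sigma> \<in> ?A. touched \<sigma> = U} = {\<sigma> \<in> ?K. touched \<sigma> = U}" using that by blast
      then show ?thesis by (simp add: f_def)
    qed
    ultimately show ?thesis by simp
  qed
  have sum_f_M: "(\<Sum>U\<in>Pow S. f U) = M (j + card S)" if "S \<subseteq> common" for S
    using sum_f[OF finite_subset[OF that finite_common]] card_touched_subset[OF \<mu> that refl]
    by (simp add: M_def j_def k_def)
  \<comment> \<open>For i up to the number of common edges, \<open>h i\<close> counts the carriers
    that touch exactly a given set of i common edges, whichever set it is.\<close>
  define h where "h i = (\<Sum>u\<le>i. (-1) ^ (i - u) * int (i choose u) * M (j + u))" for i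
  have f_h: "f S = h (card S)" if S: "S \<subseteq> common" for S
  proof -
    have finS: "finite S" using S finite_common by (rule finite_subset)
    have "f S = (\<Sum>U\<in>Pow S. (-1) ^ (card S - card U) * (\<Sum>T\<in>Pow U. f T))"
      by (rule inclusion_exclusion_mobius[OF refl finS])
    also have "\<dots> = (\<Sum>U\<in>Pow S. (-1) ^ (card S - card U) * M (j + card U))"
    proof (rule sum.cong)
      fix U assume "U \<in> Pow S"
      then have "U \<subseteq> common" using S by blast
      then show "(-1) ^ (card S - card U) * (\<Sum>T\<in>Pow U. f T) = (-1) ^ (card S - card U) * M (j + card U)"
        using sum_f_M by simp
    qed simp
    also have "\<dots> = h (card S)"
      unfolding sum_Pow_card[OF finS, of "\<lambda>u. (-1) ^ (card S - u) * M (j + u)"] h_def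
      by (simp add: mult_ac)
    finally show ?thesis .
  qed
  have touched_sub: "touched \<sigma> \<subseteq> common" for \<sigma> by (auto simp: touched_def)
  have "int (card ?K) = (\<Sum>S\<in>Pow common. f S)"
    using sum_f[OF finite_common] touched_sub by simp
  also have "\<dots> = (\<Sum>S\<in>Pow common. h (card S))" using f_h by (intro sum.cong) auto
  also have "\<dots> = (\<Sum>i\<le>t. int (t choose i) * h i)"
    unfolding sum_Pow_card[OF finite_common] t_def ..
  also have "\<dots> = (\<Sum>r\<in>{j..n}. int (t choose (r - j)) * h (r - j))"
    by (rule sum.reindex_bij_witness[of _ "\<lambda>r. r - j" "\<lambda>i. i + j"]) (auto simp: n_eq)
  finally have card_K: "int (card ?K) = (\<Sum>r\<in>{j..n}. int (t choose (r - j)) * h (r - j))" .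

  \<comment> \<open>\<open>H\<close> is \<open>h\<close> with its inner sum cut off at the lower
    bound used in \<open>zeta\<close>. For s >= j, s < \<open>\<alpha>\<close> means 2s < k, and
    these terms vanish by the next step.\<close>
  define \<alpha> where "\<alpha> = max j ((k + 1) div 2)"
  define H where "H r = (\<Sum>s\<in>{\<alpha>..r}. (-1) ^ (r - s) * int ((r - j) choose (s - j)) * M s)" for r
  have jk: "j < k" using less by (simp add: j_def k_def)
  have ex_sub: "\<exists>S\<subseteq>common. card S = i" if "i \<le> t" for i
    using that obtain_subset_with_card_n[of i common] unfolding t_def by metis
  \<comment> \<open>A permutation moving k points does not fit on 2s < k vertices. The bounds on s
    guarantee a set of s - j common edges that realises \<open>M s\<close> as a count.\<close>
  have M0: "M s = 0" if s: "j \<le> s" "s \<le> n" "2 * s < k" for s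
  proof -
    have "s - j \<le> t" using s n_eq by simp
    then obtain S where S: "S \<subseteq> common" "card S = s - j" using ex_sub[of "s - j"] by blast
    have "\<not> touched \<sigma> \<subseteq> S" if \<sigma>: "\<sigma> \<in> ?K" for \<sigma>
    proof
      assume "touched \<sigma> \<subseteq> S"
      then have \<sigma>S: "\<sigma> \<in> carriers (moved \<union> \<Union>S) \<mu> (restrict_perm (moved \<union> \<Union>S) a) (restrict_perm (moved \<union> \<Union>S) b)"
        unfolding carriers_restrict_perm[OF S(1)] using \<sigma> by simp
      have finS: "finite (moved \<union> \<Union>S)" by (rule matching_pair.fin[OF matching_pair_restrict_perm[OF S(1)]])
      have "k \<le> card (moved \<union> \<Union>S)"
        using card_mono[OF finS carriers_support(2)[OF finS \<sigma>S]] carriers_support(1)[OF finS \<sigma>S] by (simp add: k_def)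
      then show False using card_moved_Union[OF S(1)] S(2) s by (simp add: j_def)
    qed
    then have empty: "{\<sigma> \<in> ?K. touched \<sigma> \<subseteq> S} = {}" by blast
    show ?thesis
      using sum_f_M[OF S(1)] sum_f[OF finite_subset[OF S(1) finite_common]] S(2) s unfolding empty by simp
  qed
  have h_H: "h (r - j) = H r" if r: "j \<le> r" "r \<le> n" for r
  proof -
    have "h (r - j) = (\<Sum>s\<in>{j..r}. (-1) ^ (r - s) * int ((r - j) choose (s - j)) * M s)"
      unfolding h_def by (rule sum.reindex_bij_witness[of _ "\<lambda>s. s - j" "\<lambda>u. u + j"]) (use r in \<open>auto simp: add.commute\<close>)
    also have "\<dots> = H r"
      unfolding H_def
    proof (rule sum.mono_neutral_right)
      show "\<forall>s\<in>{j..r} - {\<alpha>..r}. (-1) ^ (r - s) * int ((r - j) choose (s - j)) * M s = 0"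
      proof
        fix s assume s: "s \<in> {j..r} - {\<alpha>..r}"
        then have "2 * s < k" unfolding \<alpha>_def by auto
        then show "(-1) ^ (r - s) * int ((r - j) choose (s - j)) * M s = 0" using M0[of s] s r by simp
      qed
    qed (auto simp: \<alpha>_def)
    finally show ?thesis .
  qed
  \<comment> \<open>With |S| = r - j, the bound j + 2|S| <= k reads r + (r - j) <= k, which is
    impossible for r >= k > j.\<close>
  have H0: "H r = 0" if r: "j \<le> r" "r \<le> n" "k \<le> r" for r
  proof -
    have "r - j \<le> t" using r n_eq by simp
    then obtain S where S: "S \<subseteq> common" "card S = r - j" using ex_sub[of "r - j"] by blast
    have "touched \<sigma> \<noteq> S" if "\<sigma> \<in> ?K" for \<sigma>
    proof
      assume "touched \<sigma> = S"
      then show False using touched_bound(1)[OF that] S(2) r jk by (simp add: j_def k_def)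
    qed
    then have empty: "{\<sigma> \<in> ?K. touched \<sigma> = S} = {}" by blast
    have "f S = 0" unfolding f_def empty by simp
    then show ?thesis using f_h[OF S(1)] S(2) h_H[OF r(1,2)] by simp
  qed
  have "int (card ?K) = (\<Sum>r\<in>{j..n}. int (t choose (r - j)) * H r)"
    unfolding card_K using h_H by (intro sum.cong) auto
  also have "\<dots> = (\<Sum>r\<in>{j..n} \<inter> {\<alpha>..k - 1}. int (t choose (r - j)) * H r)"
  proof (rule sum.mono_neutral_right)
    show "\<forall>r\<in>{j..n} - {j..n} \<inter> {\<alpha>..k - 1}. int (t choose (r - j)) * H r = 0"
    proof
      fix r assume r: "r \<in> {j..n} - {j..n} \<inter> {\<alpha>..k - 1}"
      then consider "r < \<alpha>" | "k \<le> r" by fastforce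
      then have "H r = 0"
      proof cases
        case 1
        then show ?thesis by (simp add: H_def)
      next
        case 2
        then show ?thesis using H0 r by simp
      qed
      then show "int (t choose (r - j)) * H r = 0" by simp
    qed
  qed auto
  \<comment> \<open>The range may now extend past n: there r - j exceeds t = n - j and the binomial
    coefficient is zero, whatever \<open>H r\<close> is.\<close>
  also have "\<dots> = (\<Sum>r\<in>{\<alpha>..k - 1}. int (t choose (r - j)) * H r)"
    by (rule sum.mono_neutral_left) (auto simp: \<alpha>_def n_eq binomial_eq_0)
  finally have card_K': "int (card ?K) = (\<Sum>r\<in>{\<alpha>..k - 1}. H r * int (t choose (r - j)))"
    by (simp add: mult.commute)
  \<comment> \<open>At the argument 2n, half of it minus j is the number of common edges, so the
    generalised binomial is an ordinary one.\<close>
  have gb: "(of_nat (2 * n) / 2 - of_nat j) gchoose (r - j) = rat_of_nat (t choose (r - j))" for r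
  proof -
    have "of_nat (2 * n) / 2 - of_nat j = rat_of_nat t" by (simp add: n_eq add_divide_distrib)
    then show ?thesis by (simp add: binomial_gbinomial)
  qed
  have "zeta ?\<tau> \<mu> (of_nat (2 * n))
      = (\<Sum>r\<in>{\<alpha>..k - 1}. of_int (H r) * ((of_nat (2 * n) / 2 - of_nat j) gchoose (r - j)))"
    unfolding zeta_def Let_def H_def M_def \<alpha>_def using jk unfolding j_def k_def by simp
  also have "\<dots> = of_int (int (card ?K))"
    unfolding card_K' gb by simp
  finally show ?thesis by simp
qed

end

subsection \<open>The top degree\<close>

lemma image_mset_mset_set_image:
  "inj_on F X \<Longrightarrow> image_mset h (mset_set (F ` X)) = image_mset (\<lambda>x. h (F x)) (mset_set X)"
  by (simp add: multiset.map_comp o_def flip: image_mset_mset_set)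

lemma funpow_restrict_perm:
  assumes "\<And>i. (f ^^ i) v \<in> D"
  shows "(restrict_perm D f ^^ k) v = (f ^^ k) v"
  using assms by (induction k) (simp_all add: restrict_perm_def)

context matching_pair
begin

text \<open>When \<^term>\<open>\<mu>\<close> and the matching type have the same size, a carrier moves exactly one vertex of each
  non-common edge and no vertex of a common edge, and on the moved vertices it agrees with \<^term>\<open>b \<circ> a\<close>. The set of moved vertices thus picks one of
  the two \<^term>\<open>b \<circ> a\<close>-orbits in every nontrivial component.\<close>

definition transversals :: "nat set set" where
  "transversals = {D. D \<subseteq> moved \<and> (\<forall>v\<in>D. b (a v) \<in> D) \<and> (\<forall>v\<in>moved. a v \<in> D \<longleftrightarrow> v \<notin> D)}"

lemma transversalsD:
  assumes "D \<in> transversals"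
  shows "D \<subseteq> moved" "v \<in> D \<Longrightarrow> b (a v) \<in> D" "v \<in> moved \<Longrightarrow> a v \<in> D \<longleftrightarrow> v \<notin> D"
  using assms unfolding transversals_def by simp_all

lemma transversals_orb:
  assumes D: "D \<in> transversals" and y: "y \<in> orb (b \<circ> a) x"
  shows "y \<in> D \<longleftrightarrow> x \<in> D"
proof -
  have pow: "((b \<circ> a) ^^ k) x \<in> D" if "x \<in> D" for k x
    by (induction k) (use that transversalsD(2)[OF D] in auto)
  have orb: "w \<in> D" if "u \<in> D" "w \<in> orb (b \<circ> a) u" for u w
    using pow[OF that(1)] that(2) unfolding orb_def by blast
  have "x \<in> orb (b \<circ> a) y"
    using orb_eq[OF ba_permutation y] self_in_orb[of x "b \<circ> a"] by simp
  then show ?thesis using orb y by blast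
qed

lemma moved_restrict_perm_transversal:
  assumes "D \<in> transversals"
  shows "{v. restrict_perm D (b \<circ> a) v \<noteq> v} = D"
proof -
  have "b (a v) \<noteq> v" if "v \<in> D" for v
    using ba_fixed_iff[of v] transversalsD(1)[OF assms] that by auto
  then show ?thesis by (auto simp: restrict_perm_def)
qed

text \<open>The cycles of the restriction are the orbits of \<open>b \<circ> a\<close> inside
  \<open>D\<close>. Adding the mirror image under \<open>a\<close> sends them bijectively to the
  nontrivial components and doubles their size.\<close>

lemma long_cycles_restrict_perm_transversal:
  assumes D: "D \<in> transversals"
  shows "long_cycles (restrict_perm D (b \<circ> a)) = matching_type a b"
proof -
  let ?g = "b \<circ> a" and ?F = "\<lambda>X. X \<union> a ` X"
  have "orb (restrict_perm D ?g) v = orb ?g v" if "v \<in> D" for v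
  proof -
    have "(?g ^^ i) v \<in> D" for i using transversals_orb[OF D funpow_in_orb] that by blast
    then have "(restrict_perm D ?g ^^ k) v = (?g ^^ k) v" for k by (rule funpow_restrict_perm)
    then show ?thesis by (simp add: orb_def)
  qed
  then have lc: "long_cycles (restrict_perm D ?g) = image_mset card (mset_set (orb ?g ` D))"
    unfolding long_cycles_def moved_restrict_perm_transversal[OF D] using image_cong by metis
  have sub: "orb ?g v \<subseteq> D" if "v \<in> D" for v using transversals_orb[OF D] that by blast
  \<comment> \<open>Intersecting a component with \<open>D\<close> recovers the chosen orbit, which
    makes \<open>?F\<close> injective.\<close>
  have FD: "?F X \<inter> D = X" if X: "X \<in> orb ?g ` D" for X
  proof -
    obtain v where v: "v \<in> D" "X = orb ?g v" using X by blast
    have "a x \<notin> D" if "x \<in> X" for x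
      using transversalsD(3)[OF D, of x] transversalsD(1)[OF D] sub[OF v(1)] v(2) that by blast
    then show ?thesis using sub[OF v(1)] v(2) by blast
  qed
  have inj: "inj_on ?F (orb ?g ` D)"
    by (rule inj_onI) (use FD in metis)
  have dorbs: "dihedral_orb a b ` moved = ?F ` orb ?g ` D"
  proof
    show "?F ` orb ?g ` D \<subseteq> dihedral_orb a b ` moved"
      using transversalsD(1)[OF D] by (auto simp: dihedral_orb_def)
    show "dihedral_orb a b ` moved \<subseteq> ?F ` orb ?g ` D"
    proof
      fix C assume "C \<in> dihedral_orb a b ` moved"
      then obtain v where v: "v \<in> moved" "C = dihedral_orb a b v" by blast
      have "\<exists>w\<in>D. C = dihedral_orb a b w"
      proof (cases "v \<in> D")
        case False
        then have "a v \<in> D" using transversalsD(3)[OF D v(1)] by blast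
        moreover have "dihedral_orb a b (a v) = C" using dihedral_orb_eq[OF a_in_dihedral_orb[OF self_in_dihedral_orb]] v(2) by simp
        ultimately show ?thesis by blast
      qed (use v in blast)
      then show "C \<in> ?F ` orb ?g ` D" unfolding dihedral_orb_def by blast
    qed
  qed
  have "matching_type a b = image_mset (\<lambda>X. card (?F X) div 2) (mset_set (orb ?g ` D))"
    unfolding matching_type_def dorbs by (rule image_mset_mset_set_image[OF inj])
  also have "\<dots> = image_mset card (mset_set (orb ?g ` D))"
  proof (rule image_mset_cong)
    fix X assume X: "X \<in># mset_set (orb ?g ` D)"
    have "finite (orb ?g ` D)"
      using finite_subset[OF transversalsD(1)[OF D] finite_moved] by simp
    then obtain v where v: "v \<in> D" "X = orb ?g v" using X by auto
    then have "v \<in> V" using transversalsD(1)[OF D] moved_subset by blast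
    then show "card (?F X) div 2 = card X" using card_dihedral_orb[of v] v(2) unfolding dihedral_orb_def by simp
  qed
  finally show ?thesis using lc by simp
qed

text \<open>Exactly one end of a non-common edge {v, a v} lies in \<open>D\<close>. If it is v, both
  sides of the intertwining relation equal a v; if it is a v, both equal b v.\<close>

lemma restrict_perm_transversal_carriers:
  assumes D: "D \<in> transversals"
  shows "restrict_perm D (b \<circ> a) \<in> carriers V (matching_type a b) a b"
proof -
  let ?\<sigma> = "restrict_perm D (b \<circ> a)"
  have finD: "finite D" using finite_subset[OF transversalsD(1)[OF D] finite_moved] .
  have inj: "inj_on (b \<circ> a) D" using permutes_inj[OF ba_permutes] inj_on_subset by blast
  have "(b \<circ> a) ` D = D"
    by (rule endo_inj_surj[OF finD _ inj]) (use transversalsD(2)[OF D] in auto)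
  then have "bij_betw (b \<circ> a) D D" using inj by (simp add: bij_betw_def)
  then have "bij_betw ?\<sigma> D D" by (rule bij_betw_cong[THEN iffD1, rotated]) (simp add: restrict_perm_def)
  then have "?\<sigma> permutes D" by (rule bij_imp_permutes) (simp add: restrict_perm_def)
  then have "?\<sigma> permutes V" by (rule permutes_subset) (use transversalsD(1)[OF D] moved_subset in blast)
  moreover have "?\<sigma> (a v) = b (?\<sigma> v)" if "v \<in> V" for v
  proof (cases "v \<in> moved")
    case True
    show ?thesis
    proof (cases "v \<in> D")
      case True
      then have "a v \<notin> D" using transversalsD(3)[OF D \<open>v \<in> moved\<close>] by blast
      then show ?thesis using True bb by (simp add: restrict_perm_def)
    next
      case False
      then have "a v \<in> D" using transversalsD(3)[OF D \<open>v \<in> moved\<close>] by blast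
      then show ?thesis using False aa by (simp add: restrict_perm_def)
    qed
  next
    case False
    then have "v \<notin> D" "a v \<notin> D" using transversalsD(1)[OF D] a_moved[of v] by blast+
    then show ?thesis using False by (simp add: restrict_perm_def)
  qed
  ultimately show ?thesis using long_cycles_restrict_perm_transversal[OF D] unfolding carriers_def by blast
qed

text \<open>Now \<sigma> moves exactly half as many points as \<open>moved\<close> contains, yet at
  least one end of each non-common edge; so it moves exactly one. If v is moved, a v is fixed, and
  \<sigma> (a v) = b (\<sigma> v) forces \<sigma> v = b (a v).\<close>

lemma carriers_top:
  assumes \<sigma>: "\<sigma> \<in> carriers V \<mu> a b" and eq: "sum_mset (matching_type a b) = sum_mset \<mu>"
  shows "\<exists>D\<in>transversals. \<sigma> = restrict_perm D (b \<circ> a)"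
proof -
  define D where "D = {v. \<sigma> v \<noteq> v}"
  have comm: "\<sigma> (a v) = b (\<sigma> v)" if "v \<in> V" for v
    using \<sigma> that unfolding carriers_def by blast
  have finD: "finite D" using carriers_support(2)[OF fin \<sigma>] finite_subset fin unfolding D_def by blast
  have cD: "card moved = 2 * card D"
    using carriers_support(1)[OF fin \<sigma>] two_sum_matching_type eq by (simp add: D_def)
  have "card D \<le> card (D \<inter> moved)"
    using touched_bound(2)[OF \<sigma>] cD by (simp add: D_def)
  then have "D \<inter> moved = D" using finD by (intro card_seteq) auto
  then have sub: "D \<subseteq> moved" by blast
  have moved: "v \<in> D \<or> a v \<in> D" if "v \<in> moved" for v
    using touched_bound(3)[OF \<sigma> that] by (simp add: D_def)
  have "moved \<subseteq> D \<union> a ` D"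
  proof
    fix v assume v: "v \<in> moved"
    then show "v \<in> D \<union> a ` D"
    proof (cases "v \<in> D")
      case False
      then have "a (a v) \<in> a ` D" using moved[OF v] by blast
      then show ?thesis by (simp add: aa)
    qed blast
  qed
  then have "card moved \<le> card (D \<union> a ` D)" using finD by (intro card_mono) auto
  moreover have "card (a ` D) = card D" using inj_a by (intro card_image) (rule inj_on_subset, auto)
  moreover have "card D + card (a ` D) = card (D \<union> a ` D) + card (D \<inter> a ` D)"
    using finD by (intro card_Un_Int) auto
  ultimately have "card (D \<inter> a ` D) = 0" using cD by simp
  then have disj: "D \<inter> a ` D = {}" using finD by simp
  have anti: "a v \<in> D \<longleftrightarrow> v \<notin> D" if "v \<in> moved" for v
    using moved[OF that] disj by blast
  have step: "\<sigma> v = b (a v)" if "v \<in> D" for v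
  proof -
    have "v \<in> V" "\<sigma> (a v) = a v" using that sub moved_subset anti[of v] unfolding D_def by blast+
    then show ?thesis using comm[of v] bb[of "\<sigma> v"] by simp
  qed
  have "b (a v) \<in> D" if "v \<in> D" for v
  proof -
    \<comment> \<open>The image of a moved point under an injective map is again moved, which makes
      \<open>D\<close> closed under \<open>b \<circ> a\<close>.\<close>
    have "\<sigma> (\<sigma> v) \<noteq> \<sigma> v"
    proof
      assume "\<sigma> (\<sigma> v) = \<sigma> v"
      moreover have "inj \<sigma>" using \<sigma> unfolding carriers_def by (auto intro: permutes_inj)
      ultimately show False using that unfolding D_def by (simp add: inj_eq)
    qed
    then show ?thesis using step[OF that] by (simp add: D_def)
  qed
  then have "D \<in> transversals" using sub anti unfolding transversals_def by blast
  moreover have "\<sigma> = restrict_perm D (b \<circ> a)"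
    using step by (auto simp: restrict_perm_def fun_eq_iff D_def)
  ultimately show ?thesis by blast
qed

text \<open>A representative of each nontrivial component singles out one of its two orbits, giving
  a reference transversal \<open>D0\<close>. Every other transversal arises by switching orbits in
  some components, so there is one for each set of components.\<close>

lemma card_transversals: "card transversals = 2 ^ size (matching_type a b)"
proof -
  define r where "r C = (SOME v. v \<in> C)" for C :: "nat set"
  define D0 where "D0 = {v \<in> moved. v \<in> orb (b \<circ> a) (r (dihedral_orb a b v))}"
  have r: "r (dihedral_orb a b v) \<in> dihedral_orb a b v" for v
    unfolding r_def using self_in_dihedral_orb[of v] by (rule someI)
  have dihedral_orb_r: "dihedral_orb a b (r (dihedral_orb a b v)) = dihedral_orb a b v" for v
    using dihedral_orb_eq[OF r] .
  have r_moved: "r (dihedral_orb a b v) \<in> moved" if "v \<in> moved" for v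
    using dihedral_orb_moved[of v "r (dihedral_orb a b v)"] that r by simp
  have v_cases: "v \<in> orb (b \<circ> a) (r (dihedral_orb a b v)) \<or> v \<in> a ` orb (b \<circ> a) (r (dihedral_orb a b v))" for v
  proof -
    have "v \<in> dihedral_orb a b (r (dihedral_orb a b v))" unfolding dihedral_orb_r by (rule self_in_dihedral_orb)
    then show ?thesis by (simp only: dihedral_orb_def[of a b "r (dihedral_orb a b v)"] Un_iff)
  qed
  have dihedral_orb_a: "dihedral_orb a b (a v) = dihedral_orb a b v" and dihedral_orb_ba: "dihedral_orb a b (b (a v)) = dihedral_orb a b v" for v
    using dihedral_orb_eq[OF a_in_dihedral_orb[OF self_in_dihedral_orb]] dihedral_orb_eq[OF b_in_dihedral_orb[OF a_in_dihedral_orb[OF self_in_dihedral_orb]]]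
    by simp_all
  have ba_moved: "b (a v) \<in> moved" if "v \<in> moved" for v
    using dihedral_orb_moved[OF _ b_in_dihedral_orb[OF a_in_dihedral_orb[OF self_in_dihedral_orb[of v]]]] that by simp
  have D0_a: "a v \<in> D0 \<longleftrightarrow> v \<notin> D0" if v: "v \<in> moved" for v
  proof -
    let ?O = "orb (b \<circ> a) (r (dihedral_orb a b v))"
    have rV: "r (dihedral_orb a b v) \<in> V" using r_moved[OF v] moved_subset by blast
    have "a v \<in> ?O \<longleftrightarrow> v \<in> a ` ?O" by (metis aa imageE imageI)
    then have "a v \<in> ?O \<longleftrightarrow> v \<notin> ?O" using v_cases[of v] orb_disjoint[OF rV] by blast
    moreover have "a v \<in> moved" using v a_moved by blast
    ultimately show ?thesis using v unfolding D0_def by (simp add: dihedral_orb_a)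
  qed
  have D0_ba: "b (a v) \<in> D0 \<longleftrightarrow> v \<in> D0" if v: "v \<in> moved" for v
  proof -
    have "orb (b \<circ> a) (b (a v)) = orb (b \<circ> a) v" using orb_step[OF ba_permutation, of v] by simp
    then have "b (a v) \<in> orb (b \<circ> a) x \<longleftrightarrow> v \<in> orb (b \<circ> a) x" for x
      using orb_eq[OF ba_permutation, of _ x] self_in_orb by metis
    then show ?thesis using v ba_moved[OF v] unfolding D0_def by (simp add: dihedral_orb_ba)
  qed
  \<comment> \<open>\<open>T X\<close> follows \<open>D0\<close> on the components in
    \<open>X\<close> and takes the opposite orbit elsewhere. Representatives lie in
    \<open>D0\<close>, so \<open>X\<close> is recovered as the components whose representative
    belongs to \<open>T X\<close>.\<close>
  define T where "T X = {v \<in> moved. v \<in> D0 \<longleftrightarrow> dihedral_orb a b v \<in> X}" for X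
  have "bij_betw T (Pow (dihedral_orb a b ` moved)) transversals"
  proof (rule bij_betw_byWitness[of _ "\<lambda>D. {C \<in> dihedral_orb a b ` moved. r C \<in> D}"])
    show "\<forall>X\<in>Pow (dihedral_orb a b ` moved). {C \<in> dihedral_orb a b ` moved. r C \<in> T X} = X"
    proof
      fix X assume X: "X \<in> Pow (dihedral_orb a b ` moved)"
      have "r C \<in> T X \<longleftrightarrow> C \<in> X" if C: "C \<in> dihedral_orb a b ` moved" for C
      proof -
        obtain v where v: "v \<in> moved" "C = dihedral_orb a b v" using C by blast
        have "r C \<in> D0" unfolding D0_def v(2) dihedral_orb_r mem_Collect_eq
          using r_moved[OF v(1)] self_in_orb by simp
        then show ?thesis using r_moved[OF v(1)] dihedral_orb_r[of v] unfolding T_def v(2) by simp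
      qed
      then show "{C \<in> dihedral_orb a b ` moved. r C \<in> T X} = X" using X by blast
    qed
    show "\<forall>D\<in>transversals. T {C \<in> dihedral_orb a b ` moved. r C \<in> D} = D"
    proof
      fix D assume D: "D \<in> transversals"
      have "(v \<in> D0 \<longleftrightarrow> r (dihedral_orb a b v) \<in> D) \<longleftrightarrow> v \<in> D" if v: "v \<in> moved" for v
        using v_cases[of v]
      proof
        assume *: "v \<in> orb (b \<circ> a) (r (dihedral_orb a b v))"
        then show ?thesis using transversals_orb[OF D *] v by (simp add: D0_def)
      next
        assume "v \<in> a ` orb (b \<circ> a) (r (dihedral_orb a b v))"
        then have *: "a v \<in> orb (b \<circ> a) (r (dihedral_orb a b v))" by (metis aa imageE)
        have "a v \<in> D0" using * v a_moved[of v] unfolding D0_def by (simp add: dihedral_orb_a)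
        then have "v \<notin> D0" using D0_a[OF v] by blast
        then show ?thesis using transversals_orb[OF D *] transversalsD(3)[OF D v] by blast
      qed
      then show "T {C \<in> dihedral_orb a b ` moved. r C \<in> D} = D"
        using transversalsD(1)[OF D] unfolding T_def by blast
    qed
    show "T ` Pow (dihedral_orb a b ` moved) \<subseteq> transversals"
    proof
      fix D assume "D \<in> T ` Pow (dihedral_orb a b ` moved)"
      then obtain X where X: "D = T X" by blast
      have "b (a v) \<in> D" if "v \<in> D" for v
        using that D0_ba[of v] ba_moved[of v] unfolding X T_def by (simp add: dihedral_orb_ba)
      moreover have "a v \<in> D \<longleftrightarrow> v \<notin> D" if v: "v \<in> moved" for v
      proof -
        have "a v \<in> moved" using v a_moved by blast
        then show ?thesis using v D0_a[OF v] unfolding X T_def mem_Collect_eq dihedral_orb_a by blast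
      qed
      moreover have "D \<subseteq> moved" unfolding X T_def by blast
      ultimately show "D \<in> transversals" unfolding transversals_def by blast
    qed
    show "(\<lambda>D. {C \<in> dihedral_orb a b ` moved. r C \<in> D}) ` transversals \<subseteq> Pow (dihedral_orb a b ` moved)"
      by blast
  qed
  then have "card transversals = 2 ^ card (dihedral_orb a b ` moved)"
    using bij_betw_same_card card_Pow finite_moved by (metis finite_imageI)
  then show ?thesis using finite_moved by (simp add: matching_type_def)
qed

text \<open>The hypothesis also admits j > k: then \<open>touched_bound\<close> leaves no carriers,
  so no partition larger than \<open>\<mu>\<close> contributes to the expansion.\<close>

lemma card_carriers_top:
  assumes "sum_mset \<mu> \<le> sum_mset (matching_type a b)"
  shows "card (carriers V \<mu> a b) = (if matching_type a b = \<mu> then 2 ^ size \<mu> else 0)"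
proof (cases "matching_type a b = \<mu>")
  case True
  have "carriers V \<mu> a b = (\<lambda>D. restrict_perm D (b \<circ> a)) ` transversals"
    using carriers_top[of _ \<mu>] restrict_perm_transversal_carriers True by auto
  moreover have "inj_on (\<lambda>D. restrict_perm D (b \<circ> a)) transversals"
    by (rule inj_onI) (use moved_restrict_perm_transversal in metis)
  ultimately show ?thesis using card_transversals True by (simp add: card_image)
next
  case False
  have "\<sigma> \<notin> carriers V \<mu> a b" for \<sigma>
  proof
    assume \<sigma>: "\<sigma> \<in> carriers V \<mu> a b"
    then have "sum_mset (matching_type a b) = sum_mset \<mu>"
      using touched_bound(1)[OF \<sigma>] assms by simp
    then obtain D where D: "D \<in> transversals" "\<sigma> = restrict_perm D (b \<circ> a)" using carriers_top[OF \<sigma>] by blast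
    then show False
      using long_cycles_restrict_perm_transversal[OF D(1)] \<sigma> False unfolding carriers_def by simp
  qed
  then have "carriers V \<mu> a b = {}" by blast
  then show ?thesis using False by simp
qed

end

subsection \<open>Expansion of the operator\<close>

text \<open>Parts are at least 2, so the sum bounds both their size and their number. Finiteness
  matters because a sum over an infinite index set is 0 by convention.\<close>

lemma finite_bounded_P2: "finite {\<tau> \<in> P2. sum_mset \<tau> < k}"
proof -
  have "\<tau> \<in> (\<lambda>(xs :: nat list). mset xs) ` {xs. set xs \<subseteq> {..k} \<and> length xs \<le> k}"
    if \<tau>: "\<tau> \<in> P2" "sum_mset \<tau> < k" for \<tau>
  proof -
    obtain xs where xs: "\<tau> = mset xs" by (metis ex_mset)
    have "x \<le> sum_mset \<tau>" if "x \<in># \<tau>" for x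
      using that by (metis insert_DiffM le_add1 sum_mset.add_mset)
    then have "set xs \<subseteq> {..k}" using \<tau>(2) xs by (auto intro: less_imp_le order_le_less_trans)
    moreover have "size \<tau> \<le> sum_mset \<tau>"
      using \<tau>(1) by (induction \<tau>) (auto simp: P2_def)
    then have "length xs \<le> k" using \<tau>(2) xs by simp
    ultimately show ?thesis using xs by blast
  qed
  then have "{\<tau> \<in> P2. sum_mset \<tau> < k} \<subseteq> mset ` {xs. set xs \<subseteq> {..k} \<and> length xs \<le> k}" by auto
  then show ?thesis
    using finite_lists_length_le[of "{..k}" k] finite_subset by blast
qed

section \<open>Matrix entries and coefficients\<close>

definition carrier_count :: "nat multiset \<Rightarrow> nat \<Rightarrow> nat set set \<Rightarrow> nat set set \<Rightarrow> nat" where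
  "carrier_count \<mu> n A B = card {\<sigma> \<in> cperms \<mu> n. relabel \<sigma> A = B}"

lemma fop_eq:
  "fop \<mu> n x B = (if B \<in> perfect_matchings (verts n)
     then \<Sum>A\<in>perfect_matchings (verts n). of_nat (carrier_count \<mu> n A B) * x A else 0)"
proof -
  let ?PM = "perfect_matchings (verts n)"
  have fin: "finite (cperms \<mu> n)"
    by (rule finite_subset[OF _ finite_permutations[OF finite_verts[of n]]]) (auto simp: cperms_def)
  have "fop \<mu> n x B = (\<Sum>A\<in>?PM. \<Sum>\<sigma>\<in>cperms \<mu> n. if relabel \<sigma> A = B then x A else 0)"
    unfolding fop_def by (rule sum.swap)
  also have "\<dots> = (\<Sum>A\<in>?PM. of_nat (carrier_count \<mu> n A B) * x A)"
  proof (rule sum.cong)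
    fix A
    have "(\<Sum>\<sigma>\<in>cperms \<mu> n. if relabel \<sigma> A = B then x A else 0)
        = (\<Sum>\<sigma>\<in>{\<sigma> \<in> cperms \<mu> n. relabel \<sigma> A = B}. x A)"
      by (rule sum.inter_filter[OF fin, symmetric])
    then show "(\<Sum>\<sigma>\<in>cperms \<mu> n. if relabel \<sigma> A = B then x A else 0) = of_nat (carrier_count \<mu> n A B) * x A"
      by (simp add: carrier_count_def)
  qed simp
  finally have eq: "fop \<mu> n x B = (\<Sum>A\<in>?PM. of_nat (carrier_count \<mu> n A B) * x A)" .
  have "carrier_count \<mu> n A B = 0" if A: "A \<in> ?PM" and B: "B \<notin> ?PM" for A
  proof -
    have "relabel \<sigma> A \<noteq> B" if "\<sigma> \<in> cperms \<mu> n" for \<sigma>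
    proof -
      have "\<sigma> permutes verts n" using that by (simp add: cperms_def)
      then show ?thesis
        using relabel_perfect_matching[OF permutes_bij A, of \<sigma>] B permutes_image[of \<sigma> "verts n"] by auto
    qed
    then have empty: "{\<sigma> \<in> cperms \<mu> n. relabel \<sigma> A = B} = {}" by blast
    show ?thesis unfolding carrier_count_def empty by simp
  qed
  then show ?thesis using eq by auto
qed

lemma carrier_count_edges:
  assumes "fpf_involution (verts n) a" "fpf_involution (verts n) b"
  shows "carrier_count \<mu> n (edges (verts n) a) (edges (verts n) b) = card (carriers (verts n) \<mu> a b)"
proof -
  have "{\<sigma> \<in> cperms \<mu> n. relabel \<sigma> (edges (verts n) a) = edges (verts n) b} = carriers (verts n) \<mu> a b"
    unfolding carriers_def cperms_def
    using filter_cycle_type[OF finite_verts] relabel_edges_eq_iff[OF _ assms] by auto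
  then show ?thesis by (simp add: carrier_count_def)
qed

text \<open>The witness is the matching type of the two partner maps. The count below the top degree
  and the count from the top degree on are merged into one coefficient formula.\<close>

lemma carrier_count_eq:
  assumes \<mu>: "\<mu> \<in> P2" and A: "A \<in> perfect_matchings (verts n)" and B: "B \<in> perfect_matchings (verts n)"
  shows "\<exists>\<tau>\<in>P2. sum_mset \<tau> \<le> n \<and> dist_part (verts n) A B = dbl (pad1 \<tau> (n - sum_mset \<tau>))
    \<and> carrier_count \<mu> n A B = (if sum_mset \<tau> < sum_mset \<mu> then of_rat (zeta \<tau> \<mu> (of_nat (2 * n)))
        else if \<tau> = \<mu> then 2 ^ size \<mu> else (0 :: complex))"
proof -
  obtain a b where ab: "fpf_involution (verts n) a" "A = edges (verts n) a" "fpf_involution (verts n) b" "B = edges (verts n) b"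
    using perfect_matching_edges A B by metis
  interpret matching_pair "verts n" a b by unfold_locales (use ab finite_verts in auto)
  let ?\<tau> = "matching_type a b"
  have count: "carrier_count \<mu> n A B = card (carriers (verts n) \<mu> a b)"
    unfolding ab(2,4) by (rule carrier_count_edges[OF ab(1,3)])
  have "of_nat (carrier_count \<mu> n A B) = (if sum_mset ?\<tau> < sum_mset \<mu> then of_rat (zeta ?\<tau> \<mu> (of_nat (2 * n)))
      else if ?\<tau> = \<mu> then 2 ^ size \<mu> else (0 :: complex))"
  proof (cases "sum_mset ?\<tau> < sum_mset \<mu>")
    case True
    have "of_nat (carrier_count \<mu> n A B) = (of_rat (of_nat (carrier_count \<mu> n A B)) :: complex)" by simp
    also have "\<dots> = of_rat (zeta ?\<tau> \<mu> (of_nat (2 * n)))"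
      unfolding count card_carriers_eq_zeta[OF \<mu> card_verts True] ..
    finally show ?thesis using True by simp
  next
    case False
    then show ?thesis using card_carriers_top[of \<mu>] by (simp add: count)
  qed
  moreover have "sum_mset ?\<tau> \<le> n" using sum_matching_type_le by (simp add: card_verts)
  moreover have "dist_part (verts n) A B = dbl (pad1 ?\<tau> (n - sum_mset ?\<tau>))"
    using dist_part_eq by (simp add: ab(2,4) card_verts)
  ultimately show ?thesis using matching_type_in_P2 by blast
qed

lemma Mop_apply:
  assumes "B \<in> perfect_matchings (verts n)"
  shows "Mop n \<tau> x B = (\<Sum>A\<in>perfect_matchings (verts n).
    (if sum_mset \<tau> \<le> n \<and> dist_part (verts n) A B = dbl (pad1 \<tau> (n - sum_mset \<tau>)) then x A else 0))"
  using assms by (simp add: Mop_def Nop_def)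

lemma Mop_outside: "B \<notin> perfect_matchings (verts n) \<Longrightarrow> Mop n \<tau> x B = 0"
  by (simp add: Mop_def Nop_def)

text \<open>At fixed A and B exactly one \<tau> in \<open>P2\<close> fits their distance, so the sum
  over \<tau> collapses to one coefficient, which is the matrix entry. There is no condition on n,
  because \<open>Mop n \<mu>\<close> is zero as soon as |\<mu>| exceeds n.\<close>

lemma fop_expansion:
  assumes \<mu>: "\<mu> \<in> P2"
  shows "fop \<mu> n x B = 2 ^ size \<mu> * Mop n \<mu> x B
    + (\<Sum>\<tau>\<in>{\<tau>\<in>P2. sum_mset \<tau> < sum_mset \<mu>}. of_rat (zeta \<tau> \<mu> (of_nat (2 * n))) * Mop n \<tau> x B)"
proof (cases "B \<in> perfect_matchings (verts n)")
  case False
  then show ?thesis by (simp add: fop_eq Mop_outside)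
next
  case B: True
  let ?PM = "perfect_matchings (verts n)" and ?T = "{\<tau>\<in>P2. sum_mset \<tau> < sum_mset \<mu>}"
  let ?d = "\<lambda>\<tau> A. sum_mset \<tau> \<le> n \<and> dist_part (verts n) A B = dbl (pad1 \<tau> (n - sum_mset \<tau>))"
  let ?z = "\<lambda>\<tau>. of_rat (zeta \<tau> \<mu> (of_nat (2 * n))) :: complex"
  have "2 ^ size \<mu> * Mop n \<mu> x B + (\<Sum>\<tau>\<in>?T. ?z \<tau> * Mop n \<tau> x B)
      = (\<Sum>A\<in>?PM. 2 ^ size \<mu> * (if ?d \<mu> A then x A else 0))
        + (\<Sum>\<tau>\<in>?T. \<Sum>A\<in>?PM. ?z \<tau> * (if ?d \<tau> A then x A else 0))"
    unfolding Mop_apply[OF B] sum_distrib_left ..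
  also have "(\<Sum>\<tau>\<in>?T. \<Sum>A\<in>?PM. ?z \<tau> * (if ?d \<tau> A then x A else 0))
      = (\<Sum>A\<in>?PM. \<Sum>\<tau>\<in>?T. ?z \<tau> * (if ?d \<tau> A then x A else 0))"
    by (rule sum.swap)
  also have "(\<Sum>A\<in>?PM. 2 ^ size \<mu> * (if ?d \<mu> A then x A else 0)) + \<dots>
      = (\<Sum>A\<in>?PM. 2 ^ size \<mu> * (if ?d \<mu> A then x A else 0)
          + (\<Sum>\<tau>\<in>?T. ?z \<tau> * (if ?d \<tau> A then x A else 0)))"
    by (rule sum.distrib[symmetric])
  also have "\<dots> = (\<Sum>A\<in>?PM. of_nat (carrier_count \<mu> n A B) * x A)"
  proof (rule sum.cong)
    fix A assume A: "A \<in> ?PM"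
    obtain \<tau> where \<tau>: "\<tau> \<in> P2" "?d \<tau> A"
      "of_nat (carrier_count \<mu> n A B) = (if sum_mset \<tau> < sum_mset \<mu> then ?z \<tau>
        else if \<tau> = \<mu> then 2 ^ size \<mu> else 0)"
      using carrier_count_eq[OF \<mu> A B] by blast
    \<comment> \<open>Doubling is injective, and a partition without parts 1 is recovered from its
      padded form, so the distance determines \<tau>.\<close>
    have d_iff: "?d \<sigma> A \<longleftrightarrow> \<sigma> = \<tau>" if "\<sigma> \<in> P2" for \<sigma>
      using \<tau>(2) pad1_inject[OF that \<tau>(1)] dbl_inject by metis
    have "(\<Sum>\<sigma>\<in>?T. ?z \<sigma> * (if ?d \<sigma> A then x A else 0))
        = (\<Sum>\<sigma>\<in>?T. if \<sigma> = \<tau> then ?z \<tau> * x A else 0)"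
      using d_iff by (intro sum.cong) auto
    also have "\<dots> = (if sum_mset \<tau> < sum_mset \<mu> then ?z \<tau> * x A else 0)"
      using finite_bounded_P2 \<tau>(1) by (simp add: sum.delta)
    finally show "2 ^ size \<mu> * (if ?d \<mu> A then x A else 0)
        + (\<Sum>\<tau>\<in>?T. ?z \<tau> * (if ?d \<tau> A then x A else 0)) = of_nat (carrier_count \<mu> n A B) * x A"
      using d_iff[OF \<mu>] \<tau>(3) by auto
  qed simp
  also have "\<dots> = fop \<mu> n x B" using B by (simp add: fop_eq)
  finally show ?thesis by simp
qed

text \<open>Here t/2 - j is the natural number n - j, while k > 2n makes the lower limit
  floor((k+1)/2) exceed n. Every binomial factor is therefore zero, whatever the values of
  m.\<close>

lemma zeta_eq_0:
  assumes "2 * n < sum_mset \<mu>" "sum_mset \<tau> \<le> n"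
  shows "zeta \<tau> \<mu> (of_nat (2 * n)) = 0"
proof -
  define j where "j = sum_mset \<tau>"
  define k where "k = sum_mset \<mu>"
  have jk: "j < k" "j \<le> n" "2 * n < k" using assms by (simp_all add: j_def k_def)
  have gchoose_0: "(of_nat (2 * n) / 2 - of_nat j) gchoose (r - j) = (0 :: rat)"
    if "r \<in> {max j ((k + 1) div 2)..k - 1}" for r
  proof -
    have "of_nat (2 * n) / 2 - of_nat j = rat_of_nat (n - j)" using jk by (simp add: of_nat_diff)
    then have "(of_nat (2 * n) / 2 - of_nat j) gchoose (r - j) = rat_of_nat ((n - j) choose (r - j))"
      by (simp only: binomial_gbinomial)
    moreover have "n - j < r - j" using that jk by auto
    ultimately show ?thesis by (simp only: binomial_eq_0 of_nat_0)
  qed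
  have "j \<noteq> k" using jk(1) by simp
  show ?thesis
    unfolding zeta_def Let_def j_def[symmetric] k_def[symmetric] if_not_P[OF \<open>j \<noteq> k\<close>] if_P[OF jk(1)]
    by (intro sum.neutral ballI) (simp only: gchoose_0 mult_zero_right)
qed

theorem theorem3p8:
  fixes \<mu> :: "nat multiset" and n :: nat
  assumes "\<mu> \<in> P2" and "1 \<le> n"
  shows "(sum_mset \<mu> \<le> n \<longrightarrow>
            (\<forall>x\<in>vecs n. fop \<mu> n x =
               (\<lambda>B. 2 ^ size \<mu> * Mop n \<mu> x B
                    + (\<Sum>\<tau>\<in>{\<tau>\<in>P2. sum_mset \<tau> < sum_mset \<mu>}.
                          of_rat (zeta \<tau> \<mu> (of_nat (2 * n))) * Mop n \<tau> x B))))
       \<and> (n < sum_mset \<mu> \<and> sum_mset \<mu> \<le> 2 * n \<longrightarrow>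
            (\<forall>x\<in>vecs n. fop \<mu> n x =
               (\<lambda>B. \<Sum>\<tau>\<in>{\<tau>\<in>P2. sum_mset \<tau> < sum_mset \<mu>}.
                          of_rat (zeta \<tau> \<mu> (of_nat (2 * n))) * Mop n \<tau> x B)))
       \<and> (2 * n < sum_mset \<mu> \<longrightarrow>
            (\<forall>\<tau>\<in>P2. sum_mset \<tau> \<le> n \<longrightarrow> zeta \<tau> \<mu> (of_nat (2 * n)) = 0))"
proof (intro conjI impI ballI)
  fix x
  show "fop \<mu> n x = (\<lambda>B. 2 ^ size \<mu> * Mop n \<mu> x B
      + (\<Sum>\<tau>\<in>{\<tau>\<in>P2. sum_mset \<tau> < sum_mset \<mu>}. of_rat (zeta \<tau> \<mu> (of_nat (2 * n))) * Mop n \<tau> x B))"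
    by (rule ext) (rule fop_expansion[OF assms(1)])
next
  fix x assume "n < sum_mset \<mu> \<and> sum_mset \<mu> \<le> 2 * n"
  then have "Mop n \<mu> x B = 0" for B by (simp add: Mop_def)
  then show "fop \<mu> n x = (\<lambda>B. \<Sum>\<tau>\<in>{\<tau>\<in>P2. sum_mset \<tau> < sum_mset \<mu>}.
      of_rat (zeta \<tau> \<mu> (of_nat (2 * n))) * Mop n \<tau> x B)"
    using fop_expansion[OF assms(1), of n x] by auto
next
  fix \<tau> assume "2 * n < sum_mset \<mu>" "sum_mset \<tau> \<le> n"
  then show "zeta \<tau> \<mu> (of_nat (2 * n)) = 0" by (rule zeta_eq_0)
qed

end
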